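(* Let $V$ be a MOSVA whose vertex operator map $Y_V$ satisfies the pole-order condition (with $W=V$, $Y_W^L=Y_V$). Let $W=\coprod_{m\in\mathbb C}W_{[m]}$ be a $\mathbb C$-graded vector space with a linear map $Y_W^L:V\otimes W\to W[[x,x^{-1}]]$ and linear operators $\mathbf d_W$ (weight $0$) and $D_W$ (weight $1$) satisfying: the axioms for the grading (items (i) of the definition of left module), the $D$-derivative property and $D$-commutator formula (item (iii)), the rationality of products of two vertex operators and of iterates of two vertex operators (item (iv) with $n\le 2$), associativity (item (v)), and the pole-order condition. Then for every $n\ge 1$, $u_1,\dots,u_n\in V$, $w\in W$, $w'\in W'$, the series $\langle w',Y_W^L(u_1,z_1)\cdots Y_W^L(u_n,z_n)w\rangle$ converges absolutely when $|z_1|>\cdots>|z_n|>0$ to a rational function with the only possible poles at $z_i=0$ ($i=1,\dots,n$) and $z_i=z_j$ ($i\neq j$). Moreover, for each $i$ the order of the pole $z_i=0$ is bounded above by an integer depending only on $u_i$ and $w$, and for each $1\le i<j\le n$ the order of the pole $z_i=z_j$ is bounded above by an integer depending only on $u_i$ and $u_j$.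
   Context: Conventions: $x$ denotes a formal variable, $z$'s complex variables. For a formal series $Y(u,x)=\sum_{k\in\mathbb Z}Y_k(u)x^{-k-1}$, a series such as $\langle w',Y(u_1,z_1)\cdots Y(u_n,z_n)w\rangle$ means the multiple complex series $\sum_{k_1,\dots,k_n}\langle w',Y_{k_1}(u_1)\cdots Y_{k_n}(u_n)w\rangle z_1^{-k_1-1}\cdots z_n^{-k_n-1}$; an iterate such as $\langle w',Y(Y(u_1,z_1-z_2)u_2,z_2)w\rangle$ means the double series in the variables $z_1-z_2$ and $z_2$ obtained from the coefficients. A meromorphic open-string vertex algebra (MOSVA) is a $\mathbb Z$-graded vector space $V=\coprod_{n\in\mathbb Z}V_{(n)}$ with a linear map $Y_V:V\otimes V\to V[[x,x^{-1}]]$, $u\otimes v\mapsto Y_V(u,x)v$, and a vacuum $\mathbf 1\in V$ such that: (i) $V_{(n)}=0$ for $n$ sufficiently negative; with $\mathbf d_Vv=nv$ for $v\in V_{(n)}$, $[\mathbf d_V,Y_V(v,x)]=x\frac{d}{dx}Y_V(v,x)+Y_V(\mathbf d_Vv,x)$; (ii) $Y_V(\mathbf 1,x)=1_V$, and $Y_V(u,x)\mathbf 1\in V[[x]]$ with $\lim_{x\to0}Y_V(u,x)\mathbf 1=u$; (iii) with $D_Vv=\lim_{x\to0}\frac{d}{dx}Y_V(v,x)\mathbf 1$, one has $\frac{d}{dx}Y_V(v,x)=Y_V(D_Vv,x)=[D_V,Y_V(v,x)]$; (iv) rationality: with $V'=\coprod_nV_{(n)}^*$, for all $u_1,\dots,u_n,v\in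 V$, $v'\in V'$, $\langle v',Y_V(u_1,z_1)\cdots Y_V(u_n,z_n)v\rangle$ converges absolutely for $|z_1|>\cdots>|z_n|>0$ to a rational function with only possible poles at $z_i=0$, $z_i=z_j$ ($i\ne j$), and $\langle v',Y_V(Y_V(u_1,z_1-z_2)u_2,z_2)v\rangle$ converges absolutely for $|z_2|>|z_1-z_2|>0$ to a rational function with only possible poles at $z_1=0,z_2=0,z_1=z_2$; (v) associativity: $\langle v',Y_V(u_1,z_1)Y_V(u_2,z_2)v\rangle=\langle v',Y_V(Y_V(u_1,z_1-z_2)u_2,z_2)v\rangle$ for $|z_1|>|z_2|>|z_1-z_2|>0$. A left $V$-module is a $\mathbb C$-graded vector space $W=\coprod_{m\in\mathbb C}W_{[m]}$ with a linear map $Y_W^L:V\otimes W\to W[[x,x^{-1}]]$, an operator $\mathbf d_W$ of weight $0$ and an operator $D_W$ of weight $1$ such that: (i) $W_{[m]}=0$ when $\mathrm{Re}(m)$ is sufficiently negative; $\mathbf d_Ww=mw$ for $w\in W_{[m]}$; $[\mathbf d_W,Y_W^L(u,x)]=Y_W^L(\mathbf d_Vu,x)+x\frac{d}{dx}Y_W^L(u,x)$; (ii) $Y_W^L(\mathbf 1,x)=1_W$; (iii) $\frac{d}{dx}Y_W^L(u,x)=Y_W^L(D_Vu,x)=[D_W,Y_W^L(u,x)]$; (iv) rationality: with $W'=\coprod_mW_{[m]}^*$, for $u_1,\dots,u_n\in V$, $w\in W$, $w'\in W'$, $\langle w',Y_W^L(u_1,z_1)\cdots Y_W^L(u_n,z_n)w\rangle$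 converges absolutely for $|z_1|>\cdots>|z_n|>0$ to a rational function with only possible poles at $z_i=0$ and $z_i=z_j$ ($i\neq j$), and $\langle w',Y_W^L(Y_V(u_1,z_1-z_2)u_2,z_2)w\rangle$ converges absolutely for $|z_2|>|z_1-z_2|>0$ to a rational function with only possible poles at $z_1=0,z_2=0,z_1=z_2$; (v) associativity: $\langle w',Y_W^L(u_1,z_1)Y_W^L(u_2,z_2)w\rangle=\langle w',Y_W^L(Y_V(u_1,z_1-z_2)u_2,z_2)w\rangle$ for $|z_1|>|z_2|>|z_1-z_2|>0$. Pole-order condition: for every $w'\in W'$, $u_1,u_2\in V$, $w\in W$, the order of the pole $z_1=0$ of the rational function to which $\langle w',Y_W^L(u_1,z_1)Y_W^L(u_2,z_2)w\rangle$ converges is bounded above by an integer depending only on $u_1$ and $w$ (not on $u_2$ or $w'$). *)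

theory Defs
  imports "HOL-Analysis.Analysis"
begin

definition mpoly :: "nat \<Rightarrow> ((nat \<Rightarrow> nat) \<Rightarrow> complex) \<Rightarrow> bool" where
  "mpoly n P \<longleftrightarrow> finite {\<alpha>. P \<alpha> \<noteq> 0} \<and> (\<forall>\<alpha>. P \<alpha> \<noteq> 0 \<longrightarrow> (\<forall>i\<ge>n. \<alpha> i = 0))"

definition mpoly_eval :: "nat \<Rightarrow> ((nat \<Rightarrow> nat) \<Rightarrow> complex) \<Rightarrow> (nat \<Rightarrow> complex) \<Rightarrow> complex" where
  "mpoly_eval n P z = (\<Sum>\<alpha>\<in>{\<alpha>. P \<alpha> \<noteq> 0}. P \<alpha> * (\<Prod>i<n. z i ^ \<alpha> i))"

text \<open>The rational function P(z) / (prod_i z_i^(a i) * prod_(i<j) (z_i - z_j)^(b i j)):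
  the general rational function whose only possible poles are at z_i = 0 and z_i = z_j,
  the exponents a i, b i j bounding the orders of these poles.\<close>

definition rat_fun :: "nat \<Rightarrow> ((nat \<Rightarrow> nat) \<Rightarrow> complex) \<Rightarrow> (nat \<Rightarrow> nat) \<Rightarrow> (nat \<Rightarrow> nat \<Rightarrow> nat)
    \<Rightarrow> (nat \<Rightarrow> complex) \<Rightarrow> complex" where
  "rat_fun n P a b z = mpoly_eval n P z /
     ((\<Prod>i<n. z i ^ a i) * (\<Prod>i<n. \<Prod>j\<in>{i<..<n}. (z i - z j) ^ b i j))"

definition idx :: "nat \<Rightarrow> (nat \<Rightarrow> int) set" where
  "idx n = {k. \<forall>i\<ge>n. k i = 0}"

definition conv_rat :: "nat \<Rightarrow> ((nat \<Rightarrow> int) \<Rightarrow> (nat \<Rightarrow> complex) \<Rightarrow> complex) \<Rightarrow> (nat \<Rightarrow> complex) set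
    \<Rightarrow> (nat \<Rightarrow> nat) \<Rightarrow> (nat \<Rightarrow> nat \<Rightarrow> nat) \<Rightarrow> bool" where
  "conv_rat n t D a b \<longleftrightarrow> (\<exists>P. mpoly n P \<and>
     (\<forall>z\<in>D. (\<lambda>k. norm (t k z)) summable_on idx n \<and> ((\<lambda>k. t k z) has_sum rat_fun n P a b z) (idx n)))"

definition Dprod :: "nat \<Rightarrow> (nat \<Rightarrow> complex) set" where
  "Dprod n = {z. (\<forall>i<n. 0 < norm (z i)) \<and> (\<forall>i. Suc i < n \<longrightarrow> norm (z (Suc i)) < norm (z i))}"

definition Diter :: "(nat \<Rightarrow> complex) set" where
  "Diter = {z. norm (z 0 - z 1) < norm (z 1) \<and> 0 < norm (z 0 - z 1)}"

definition Dassoc :: "(nat \<Rightarrow> complex) set" where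
  "Dassoc = {z. norm (z 1) < norm (z 0) \<and> norm (z 0 - z 1) < norm (z 1) \<and> 0 < norm (z 0 - z 1)}"

definition graded :: "(complex \<Rightarrow> 'v::ab_group_add \<Rightarrow> 'v) \<Rightarrow> ('i \<Rightarrow> 'v set) \<Rightarrow> bool" where
  "graded s G \<longleftrightarrow> vector_space s \<and> (\<forall>i. module.subspace s (G i)) \<and>
     (\<forall>v. \<exists>S c. finite S \<and> (\<forall>i\<in>S. c i \<in> G i) \<and> v = (\<Sum>i\<in>S. c i)) \<and>
     (\<forall>S c. finite S \<and> (\<forall>i\<in>S. c i \<in> G i) \<and> (\<Sum>i\<in>S. c i) = 0 \<longrightarrow> (\<forall>i\<in>S. c i = 0))"

text \<open>Graded dual W' = coprod_m (W_[m])^*, realised as the linear functionals on W vanishing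
  on all but finitely many homogeneous subspaces.\<close>

definition gdual :: "(complex \<Rightarrow> 'v::ab_group_add \<Rightarrow> 'v) \<Rightarrow> ('i \<Rightarrow> 'v set) \<Rightarrow> ('v \<Rightarrow> complex) set" where
  "gdual s G = {f. Vector_Spaces.linear s (*) f \<and>
     (\<exists>S. finite S \<and> (\<forall>m. m \<notin> S \<longrightarrow> (\<forall>w\<in>G m. f w = 0)))}"

text \<open>A vertex operator map Y : V (x) W \<rightarrow> W[[x,x^-1]] is given by its modes:
  Y(u,x)w = sum_k Y k u w x^(-k-1).\<close>

definition bilinear_Y :: "(complex \<Rightarrow> 'v::ab_group_add \<Rightarrow> 'v) \<Rightarrow> (complex \<Rightarrow> 'w::ab_group_add \<Rightarrow> 'w)
    \<Rightarrow> (int \<Rightarrow> 'v \<Rightarrow> 'w \<Rightarrow> 'w) \<Rightarrow> bool" where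
  "bilinear_Y sV sW Y \<longleftrightarrow> (\<forall>k u. Vector_Spaces.linear sW sW (Y k u)) \<and>
     (\<forall>k w. Vector_Spaces.linear sV sW (\<lambda>u. Y k u w))"

fun opprod :: "(int \<Rightarrow> 'v \<Rightarrow> 'w \<Rightarrow> 'w) \<Rightarrow> (nat \<Rightarrow> 'v) \<Rightarrow> (nat \<Rightarrow> int) \<Rightarrow> nat \<Rightarrow> nat \<Rightarrow> 'w \<Rightarrow> 'w" where
  "opprod Y u k i 0 w = w"
| "opprod Y u k i (Suc m) w = Y (k i) (u i) (opprod Y u k (Suc i) m w)"

definition prod_term :: "(int \<Rightarrow> 'v \<Rightarrow> 'w \<Rightarrow> 'w) \<Rightarrow> ('w \<Rightarrow> complex) \<Rightarrow> (nat \<Rightarrow> 'v) \<Rightarrow> nat \<Rightarrow> 'w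
    \<Rightarrow> (nat \<Rightarrow> int) \<Rightarrow> (nat \<Rightarrow> complex) \<Rightarrow> complex" where
  "prod_term Y f u n w k z = f (opprod Y u k 0 n w) * (\<Prod>i<n. z i powi (- k i - 1))"

definition iter_term :: "(int \<Rightarrow> 'v \<Rightarrow> 'w \<Rightarrow> 'w) \<Rightarrow> (int \<Rightarrow> 'v \<Rightarrow> 'v \<Rightarrow> 'v) \<Rightarrow> ('w \<Rightarrow> complex)
    \<Rightarrow> 'v \<Rightarrow> 'v \<Rightarrow> 'w \<Rightarrow> (nat \<Rightarrow> int) \<Rightarrow> (nat \<Rightarrow> complex) \<Rightarrow> complex" where
  "iter_term YW YV f u1 u2 w k z =
     f (YW (k 1) (YV (k 0) u1 u2) w) * (z 0 - z 1) powi (- k 0 - 1) * z 1 powi (- k 1 - 1)"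

definition pair :: "'v \<Rightarrow> 'v \<Rightarrow> nat \<Rightarrow> 'v" where
  "pair u1 u2 = (\<lambda>i. if i = 0 then u1 else u2)"

definition rational_prod :: "(complex \<Rightarrow> 'w::ab_group_add \<Rightarrow> 'w) \<Rightarrow> ('i \<Rightarrow> 'w set)
    \<Rightarrow> (int \<Rightarrow> 'v \<Rightarrow> 'w \<Rightarrow> 'w) \<Rightarrow> nat \<Rightarrow> bool" where
  "rational_prod sW G Y n \<longleftrightarrow>
     (\<forall>u w. \<forall>f\<in>gdual sW G. \<exists>a b. conv_rat n (prod_term Y f u n w) (Dprod n) a b)"

definition rational_iter :: "(complex \<Rightarrow> 'w::ab_group_add \<Rightarrow> 'w) \<Rightarrow> ('i \<Rightarrow> 'w set)
    \<Rightarrow> (int \<Rightarrow> 'v \<Rightarrow> 'w \<Rightarrow> 'w) \<Rightarrow> (int \<Rightarrow> 'v \<Rightarrow> 'v \<Rightarrow> 'v) \<Rightarrow> bool" where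
  "rational_iter sW G YW YV \<longleftrightarrow>
     (\<forall>u1 u2 w. \<forall>f\<in>gdual sW G. \<exists>a b. conv_rat 2 (iter_term YW YV f u1 u2 w) Diter a b)"

definition assoc_ax :: "(complex \<Rightarrow> 'w::ab_group_add \<Rightarrow> 'w) \<Rightarrow> ('i \<Rightarrow> 'w set)
    \<Rightarrow> (int \<Rightarrow> 'v \<Rightarrow> 'w \<Rightarrow> 'w) \<Rightarrow> (int \<Rightarrow> 'v \<Rightarrow> 'v \<Rightarrow> 'v) \<Rightarrow> bool" where
  "assoc_ax sW G YW YV \<longleftrightarrow>
     (\<forall>u1 u2 w. \<forall>f\<in>gdual sW G. \<forall>z\<in>Dassoc.
        infsum (\<lambda>k. prod_term YW f (pair u1 u2) 2 w k z) (idx 2) =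
        infsum (\<lambda>k. iter_term YW YV f u1 u2 w k z) (idx 2))"

definition pole_order :: "(complex \<Rightarrow> 'w::ab_group_add \<Rightarrow> 'w) \<Rightarrow> ('i \<Rightarrow> 'w set)
    \<Rightarrow> (int \<Rightarrow> 'v \<Rightarrow> 'w \<Rightarrow> 'w) \<Rightarrow> bool" where
  "pole_order sW G Y \<longleftrightarrow> (\<exists>N :: 'v \<Rightarrow> 'w \<Rightarrow> nat.
     \<forall>u1 u2 w. \<forall>f\<in>gdual sW G. \<exists>a b. a 0 \<le> N u1 w \<and>
        conv_rat 2 (prod_term Y f (pair u1 u2) 2 w) (Dprod 2) a b)"

text \<open>Modes: Y(u,x)v = sum_k YV k u v x^(-k-1); vacuum vac; d_V grading operator;
  D_V v = lim_(x->0) d/dx Y(v,x) vac = YV (-2) v vac.\<close>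

definition mosva :: "(complex \<Rightarrow> 'v::ab_group_add \<Rightarrow> 'v) \<Rightarrow> (int \<Rightarrow> 'v set)
    \<Rightarrow> (int \<Rightarrow> 'v \<Rightarrow> 'v \<Rightarrow> 'v) \<Rightarrow> 'v \<Rightarrow> ('v \<Rightarrow> 'v) \<Rightarrow> bool" where
  "mosva sV GV YV vac dV \<longleftrightarrow>
     graded sV GV \<and> bilinear_Y sV sV YV \<and>
     \<comment> \<open>(i)\<close>
     (\<exists>M. \<forall>n<M. GV n = {0}) \<and>
     Vector_Spaces.linear sV sV dV \<and> (\<forall>n. \<forall>v\<in>GV n. dV v = sV (of_int n) v) \<and>
     (\<forall>k u v. dV (YV k u v) - YV k u (dV v) = sV (of_int (- k - 1)) (YV k u v) + YV k (dV u) v) \<and>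
     \<comment> \<open>(ii)\<close>
     (\<forall>k v. YV k vac v = (if k = -1 then v else 0)) \<and>
     (\<forall>u k. k \<ge> 0 \<longrightarrow> YV k u vac = 0) \<and> (\<forall>u. YV (-1) u vac = u) \<and>
     \<comment> \<open>(iii)\<close>
     (\<forall>k u v. YV k (YV (-2) u vac) v = sV (of_int (- k)) (YV (k - 1) u v) \<and>
        YV (-2) (YV k u v) vac - YV k u (YV (-2) v vac) = sV (of_int (- k)) (YV (k - 1) u v)) \<and>
     \<comment> \<open>(iv)\<close>
     (\<forall>n. rational_prod sV GV YV n) \<and> rational_iter sV GV YV YV \<and>
     \<comment> \<open>(v)\<close>
     assoc_ax sV GV YV YV"

end

theory Submission
  imports Defs "HOL-Library.Multiset"
begin

text \<open>
  The pole-order condition turns associativity into a formal identity (weak associativity):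
  with an exponent N depending only on u and w,
    (x0 + x1)^N Y(u, x0 + x1) Y(v, x1) w = (x0 + x1)^N Y(Y(u, x0) v, x1) w.
  Applying it to the operators one after the other, substituting x_i = y_i + x_p for
  i = p-1, ..., 0, relates
  Y(u_0, x_0) ... Y(u_p, x_p) w to Y(Y(u_0, y_0) ... Y(u_{p-1}, y_{p-1}) u_p, x_p) w. The inner product
  lives in V and has one factor less, so by induction it becomes regular in the y_i after
  multiplication by powers of y_i and y_i - y_j whose exponents depend only on the vectors
  involved. Since y_i - y_j = x_i - x_j and y_i = x_i - x_p, the product on W multiplied by
  powers of x_i and x_i - x_j has no negative powers of any variable. The grading confines it
  to finitely many total degrees, so it is a polynomial, and the factors x_i - x_j can be
  divided out again by geometric series in x_j / x_i, which converge where |x_j| < |x_i|.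
\<close>

section \<open>Multiplication by linear forms and translation of variables\<close>

text \<open>For n >= 3 nothing is known beforehand about convergence, so the products cannot be
  treated as functions to be continued from one region to another. Analysis is therefore confined to
  the case of two operators, where it yields weak associativity, and to the final division;
  everything between is an identity of coefficient families. Weak associativity is used with v
  itself a product in V and underneath further operators. Hence it has to be an identity of vectors
  with an exponent independent of v and w', and the pole-order condition gives just that. Truncation
  along antidiagonals plays the part of a region |x_j| < |x_i|: without it x_i - x_j could be a zero
  divisor, as the formal delta function shows. Origin of the bounds: the exponent for (u_i, w) on W
  bounds the pole z_i = 0. Since x_i - x_p = y_i is a variable of a product on V acting on u_p, the
  same kind of exponent, formed on V for (u_i, u_p), bounds the pole z_i = z_p. The induction runs
  over V alone; W is reached from V in a single step.\<close>

text \<open>A formal series is the family T of its coefficients, T k being the coefficient of the product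
  of the x_i^(-k i - 1); hence multiplication by x_i shifts k i up by 1, and negative powers of x_i
  correspond to k i \<ge> 0. A linear form is the family l of its coefficients.\<close>

definition linform_mult :: "(complex \<Rightarrow> 'w::ab_group_add \<Rightarrow> 'w) \<Rightarrow> nat \<Rightarrow> (nat \<Rightarrow> complex)
    \<Rightarrow> ((nat \<Rightarrow> int) \<Rightarrow> 'w) \<Rightarrow> (nat \<Rightarrow> int) \<Rightarrow> 'w" where
  "linform_mult s n l T k = (\<Sum>i<n. s (l i) (T (k(i := k i + 1))))"

definition linform_mults :: "(complex \<Rightarrow> 'w::ab_group_add \<Rightarrow> 'w) \<Rightarrow> nat \<Rightarrow> (nat \<Rightarrow> complex) list
    \<Rightarrow> ((nat \<Rightarrow> int) \<Rightarrow> 'w) \<Rightarrow> (nat \<Rightarrow> int) \<Rightarrow> 'w" where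
  "linform_mults s n ls = foldr (linform_mult s n) ls"

definition xvar :: "nat \<Rightarrow> nat \<Rightarrow> complex" where
  "xvar i = (\<lambda>j. if j = i then 1 else 0)"

definition xdiff :: "nat \<Rightarrow> nat \<Rightarrow> nat \<Rightarrow> complex" where
  "xdiff i j = (\<lambda>m. xvar i m - xvar j m)"

text \<open>These are the monomials of equal total degree whose expansion, once x_j becomes x_j +
  x_p, can meet the monomial of mode \<open>k\<close>: the power of x_j rises by m and that of x_p
  falls by m. The same line of modes appears when 1/(x_j - x_p) is expanded.\<close>

definition antidiagonal :: "nat \<Rightarrow> nat \<Rightarrow> nat \<Rightarrow> (nat \<Rightarrow> int) \<Rightarrow> nat \<Rightarrow> int" where
  "antidiagonal j p m k = k(j := k j - int m, p := k p + int m)"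

text \<open>This replaces a region of convergence: it makes the sums in \<open>translate\<close>
  finite and lets the telescoping sums of \<open>has_sum_xdiff_cancel\<close> end.\<close>

definition truncated :: "nat \<Rightarrow> nat \<Rightarrow> ((nat \<Rightarrow> int) \<Rightarrow> 'w::zero) \<Rightarrow> bool" where
  "truncated j p T \<longleftrightarrow> (\<forall>k. \<exists>B. \<forall>m\<ge>B. T (antidiagonal j p m k) = 0)"

text \<open>No negative powers of x_i.\<close>

definition regular :: "nat \<Rightarrow> ((nat \<Rightarrow> int) \<Rightarrow> 'w::zero) \<Rightarrow> bool" where
  "regular i T \<longleftrightarrow> (\<forall>k. k i \<ge> 0 \<longrightarrow> T k = 0)"

definition translate_coef :: "int \<Rightarrow> nat \<Rightarrow> complex" where
  "translate_coef a m = (-1) ^ m * (of_int a gchoose m)"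

text \<open>The substitution of x_j + x_p for x_j, expanded in nonnegative powers of x_p: the coefficient
  of x_p^m in (x_j + x_p)^(m - k - 1) is (m - k - 1 choose m) = (-1)^m (k choose m). The sum is
  meaningful only for truncated T; otherwise its index set may be infinite and the sum is 0.\<close>

definition translate :: "(complex \<Rightarrow> 'w::ab_group_add \<Rightarrow> 'w) \<Rightarrow> nat \<Rightarrow> nat
    \<Rightarrow> ((nat \<Rightarrow> int) \<Rightarrow> 'w) \<Rightarrow> (nat \<Rightarrow> int) \<Rightarrow> 'w" where
  "translate s j p T k = (\<Sum>m | T (antidiagonal j p m k) \<noteq> 0. s (translate_coef (k j) m) (T (antidiagonal j p m k)))"

locale complex_vector_space = vector_space s for s :: "complex \<Rightarrow> 'w::ab_group_add \<Rightarrow> 'w"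

lemma linform_mults_simps [simp]:
  "linform_mults s n [] T = T" "linform_mults s n (l # ls) T = linform_mult s n l (linform_mults s n ls T)"
  by (simp_all add: linform_mults_def)

lemma linform_mults_append: "linform_mults s n (xs @ ys) T = linform_mults s n xs (linform_mults s n ys T)"
  by (simp add: linform_mults_def)

lemma antidiagonal_same [simp]: "j \<noteq> p \<Longrightarrow> antidiagonal j p m k j = k j - int m" "antidiagonal j p m k p = k p + int m"
  and antidiagonal_other: "i \<noteq> j \<Longrightarrow> i \<noteq> p \<Longrightarrow> antidiagonal j p m k i = k i"
  and antidiagonal_0 [simp]: "antidiagonal j p 0 k = k"
  by (auto simp: antidiagonal_def)

lemma antidiagonal_antidiagonal: "j \<noteq> p \<Longrightarrow> antidiagonal j p m (antidiagonal j p m' k) = antidiagonal j p (m + m') k"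
  by (auto simp: antidiagonal_def fun_eq_iff)

lemma antidiagonal_bump: "j \<noteq> p \<Longrightarrow> (antidiagonal j p m k)(i := antidiagonal j p m k i + 1) = antidiagonal j p m (k(i := k i + 1))"
  by (auto simp: antidiagonal_def fun_eq_iff)

lemma antidiagonal_Suc_bump: "j \<noteq> p \<Longrightarrow> antidiagonal j p (Suc m) (k(j := k j + 1)) = antidiagonal j p m (k(p := k p + 1))"
  by (auto simp: antidiagonal_def fun_eq_iff)

lemma translate_coef_0 [simp]: "translate_coef a 0 = 1"
  by (simp add: translate_coef_def)

text \<open>A power (x_j + x_p)^b with b = m - a - 1 >= 0 is a polynomial, so it contributes nothing
  to the negative power of x_j that the mode a >= 0 stands for.\<close>

lemma translate_coef_eq_0: "0 \<le> a \<Longrightarrow> a < int m \<Longrightarrow> translate_coef a m = 0"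
proof -
  assume a: "0 \<le> a" "a < int m"
  then obtain b where b: "a = int b" using nonneg_int_cases by blast
  have "(of_nat b gchoose m :: complex) = of_nat (b choose m)"
    by (simp add: binomial_gbinomial)
  then show ?thesis using a b by (simp add: translate_coef_def)
qed

text \<open>Pascal's rule, in the form in which multiplication by x_j turns into multiplication by
  x_j + x_p.\<close>

lemma translate_coef_Suc: "translate_coef (a + 1) (Suc m) + translate_coef a m = translate_coef a (Suc m)"
proof -
  have "(of_int (a + 1) gchoose Suc m :: complex) = (of_int a gchoose m) + (of_int a gchoose Suc m)"
    using gbinomial_Suc_Suc[of "of_int a :: complex" m] by simp
  then show ?thesis by (simp only: translate_coef_def) (simp add: algebra_simps)
qed

lemma regularD: "regular i T \<Longrightarrow> k i \<ge> 0 \<Longrightarrow> T k = 0"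
  by (simp add: regular_def)

context complex_vector_space
begin

lemma linform_mult_commute: "linform_mult s n l (linform_mult s n l' T) = linform_mult s n l' (linform_mult s n l T)"
proof
  fix k
  have "linform_mult s n l (linform_mult s n l' T) k =
      (\<Sum>i<n. \<Sum>j<n. s (l i * l' j) (T ((k(i := k i + 1))(j := (k(i := k i + 1)) j + 1))))"
    by (simp add: linform_mult_def scale_sum_right del: fun_upd_apply)
  also have "\<dots> = (\<Sum>j<n. \<Sum>i<n. s (l i * l' j) (T ((k(i := k i + 1))(j := (k(i := k i + 1)) j + 1))))"
    by (rule sum.swap)
  also have "\<dots> = (\<Sum>j<n. \<Sum>i<n. s (l' j * l i) (T ((k(j := k j + 1))(i := (k(j := k j + 1)) i + 1))))"
    by (intro sum.cong refl arg_cong2[where f = s] arg_cong[where f = T]) (auto simp: fun_eq_iff)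
  also have "\<dots> = linform_mult s n l' (linform_mult s n l T) k"
    by (simp add: linform_mult_def scale_sum_right del: fun_upd_apply)
  finally show "linform_mult s n l (linform_mult s n l' T) k = linform_mult s n l' (linform_mult s n l T) k" .
qed

text \<open>Since multiplications commute, any factor can be moved next to the series, which is
  where weak associativity needs it.\<close>

lemma linform_mults_mset: "mset xs = mset ys \<Longrightarrow> linform_mults s n xs = linform_mults s n ys"
proof -
  assume m: "mset xs = mset ys"
  have c: "linform_mult s n x \<circ> linform_mult s n y = linform_mult s n y \<circ> linform_mult s n x" for x y
    by (simp add: fun_eq_iff linform_mult_commute)
  have "fold (linform_mult s n) xs = fold (linform_mult s n) ys"
    by (rule fold_multiset_equiv[OF _ m]) (use c in blast)
  then show ?thesis
    unfolding linform_mults_def using foldr_fold c by metis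
qed

lemma linform_mult_xvar: "i < n \<Longrightarrow> linform_mult s n (xvar i) T k = T (k(i := k i + 1))"
  by (simp add: linform_mult_def xvar_def if_distrib[of "\<lambda>c. s c _"] sum.delta cong: if_cong)

lemma linform_mults_replicate_xvar:
  "i < n \<Longrightarrow> linform_mults s n (replicate r (xvar i)) T k = T (k(i := k i + int r))"
  by (induction r arbitrary: k) (auto simp: linform_mult_xvar algebra_simps)

lemma linform_mult_regular: "regular i T \<Longrightarrow> regular i (linform_mult s n l T)"
  unfolding regular_def linform_mult_def
proof (intro allI impI sum.neutral ballI)
  fix k :: "nat \<Rightarrow> int" and j
  assume T: "\<forall>k. 0 \<le> k i \<longrightarrow> T k = 0" and k: "0 \<le> k i"
  have "0 \<le> (k(j := k j + 1)) i" using k by auto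
  then have "T (k(j := k j + 1)) = 0" using T by blast
  then show "s (l j) (T (k(j := k j + 1))) = 0" by simp
qed

lemma linform_mults_regular: "regular i T \<Longrightarrow> regular i (linform_mults s n ls T)"
  by (induction ls) (auto intro: linform_mult_regular)

lemma truncated_bump:
  assumes "truncated j p T"
  obtains B where "\<And>i m. i < n \<Longrightarrow> m \<ge> B \<Longrightarrow> T (antidiagonal j p m (k(i := k i + 1))) = 0"
proof -
  have "\<forall>i. \<exists>B. \<forall>m\<ge>B. T (antidiagonal j p m (k(i := k i + 1))) = 0"
    using assms by (auto simp: truncated_def)
  then obtain B where B: "\<And>i m. m \<ge> B i \<Longrightarrow> T (antidiagonal j p m (k(i := k i + 1))) = 0"
    by metis
  show ?thesis
  proof (rule that[of "Max (B ` {..<n})"])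
    fix i m assume "i < n" "m \<ge> Max (B ` {..<n})"
    then have "B i \<le> m"
      by (meson Max_ge dual_order.trans finite_imageI finite_lessThan imageI lessThan_iff)
    then show "T (antidiagonal j p m (k(i := k i + 1))) = 0" by (rule B)
  qed
qed

lemma truncated_linform_mult: "j \<noteq> p \<Longrightarrow> truncated j p T \<Longrightarrow> truncated j p (linform_mult s n l T)"
  unfolding truncated_def[of _ _ "linform_mult s n l T"]
proof (intro allI)
  fix k assume jp: "j \<noteq> p" and T: "truncated j p T"
  obtain B where "\<And>i m. i < n \<Longrightarrow> m \<ge> B \<Longrightarrow> T (antidiagonal j p m (k(i := k i + 1))) = 0"
    using truncated_bump[OF T] by blast
  then show "\<exists>B. \<forall>m\<ge>B. linform_mult s n l T (antidiagonal j p m k) = 0"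
    by (intro exI[of _ B]) (auto simp: linform_mult_def antidiagonal_bump[OF jp] intro!: sum.neutral)
qed

lemma truncated_linform_mults: "j \<noteq> p \<Longrightarrow> truncated j p T \<Longrightarrow> truncated j p (linform_mults s n ls T)"
  by (induction ls) (auto intro: truncated_linform_mult)

lemma translate_eq:
  assumes "\<And>m. m \<ge> B \<Longrightarrow> T (antidiagonal j p m k) = 0"
  shows "translate s j p T k = (\<Sum>m<B. s (translate_coef (k j) m) (T (antidiagonal j p m k)))"
  unfolding translate_def
  by (rule sum.mono_neutral_left) (use assms linorder_not_less in auto)

text \<open>Substitution respects products: with x_j replaced by x_j + x_p, the coefficient of x_j
  in the form is added to that of x_p. Truncation gives one bound for all shifted arguments, so
  every sum is finite.\<close>

lemma translate_linform_mult:
  assumes jp: "j \<noteq> p" "j < n" "p < n" and T: "truncated j p T"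
  shows "translate s j p (linform_mult s n l T) = linform_mult s n (l(p := l p + l j)) (translate s j p T)"
proof
  fix k
  obtain B where B: "\<And>i m. i < n \<Longrightarrow> m \<ge> B \<Longrightarrow> T (antidiagonal j p m (k(i := k i + 1))) = 0"
    using truncated_bump[OF T] by blast
  let ?b = "\<lambda>i. k(i := k i + 1)"
  let ?P = "translate s j p T"
  let ?S = "\<lambda>i. \<Sum>m<Suc B. s (translate_coef (k j) m) (T (antidiagonal j p m (?b i)))"
  have "translate s j p (linform_mult s n l T) k = (\<Sum>m<Suc B. s (translate_coef (k j) m) (linform_mult s n l T (antidiagonal j p m k)))"
    by (rule translate_eq) (auto simp: linform_mult_def antidiagonal_bump[OF jp(1)] B intro!: sum.neutral)
  also have "\<dots> = (\<Sum>m<Suc B. \<Sum>i<n. s (translate_coef (k j) m * l i) (T (antidiagonal j p m (?b i))))"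
    by (simp add: linform_mult_def antidiagonal_bump[OF jp(1)] scale_sum_right)
  also have "\<dots> = (\<Sum>i<n. s (l i) (?S i))"
    by (subst sum.swap) (simp add: scale_sum_right mult.commute del: sum.lessThan_Suc)
  finally have L: "translate s j p (linform_mult s n l T) k = (\<Sum>i<n. s (l i) (?S i))" .
  have S: "?P (?b i) = ?S i" if "i < n" "i \<noteq> j" for i
    by (subst translate_eq[of "Suc B"]) (use B that in auto)
  \<comment> \<open>Raising the mode of x_j changes the upper index of the binomial coefficient; the
    term with x_p raised supplies the missing summand of Pascal's rule.\<close>
  have Sj: "?P (?b j) + ?P (?b p) = ?S j"
  proof -
    have 1: "?P (?b j) = (\<Sum>m<Suc B. s (translate_coef (k j + 1) m) (T (antidiagonal j p m (?b j))))"
      by (subst translate_eq[of "Suc B"]) (use B jp in auto)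
    have 2: "?P (?b p) = (\<Sum>m<B. s (translate_coef (k j) m) (T (antidiagonal j p (Suc m) (?b j))))"
      by (subst translate_eq[of B]) (use B jp in \<open>auto simp: antidiagonal_Suc_bump[OF jp(1)]\<close>)
    have "?P (?b j) + ?P (?b p) = T (?b j) +
       (\<Sum>m<B. s (translate_coef (k j + 1) (Suc m) + translate_coef (k j) m) (T (antidiagonal j p (Suc m) (?b j))))"
      unfolding 1 2 sum.lessThan_Suc_shift by (simp add: sum.distrib scale_left_distrib)
    also have "\<dots> = ?S j"
      unfolding translate_coef_Suc sum.lessThan_Suc_shift by simp
    finally show ?thesis .
  qed
  have "linform_mult s n (l(p := l p + l j)) ?P k = (\<Sum>i<n. s (l i) (?P (?b i)) + (if i = p then s (l j) (?P (?b p)) else 0))"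
    unfolding linform_mult_def by (intro sum.cong) (auto simp: scale_left_distrib)
  also have "\<dots> = (\<Sum>i<n. s (l i) (?P (?b i))) + s (l j) (?P (?b p))"
    using jp by (simp add: sum.distrib)
  also have "\<dots> = (\<Sum>i\<in>{..<n}-{j}. s (l i) (?P (?b i))) + s (l j) (?P (?b j) + ?P (?b p))"
    using jp by (subst sum.remove[of _ j]) (auto simp: scale_right_distrib)
  also have "\<dots> = (\<Sum>i\<in>{..<n}-{j}. s (l i) (?S i)) + s (l j) (?S j)"
    unfolding Sj using S by (intro arg_cong2[where f = "(+)"] sum.cong) (auto simp del: sum.lessThan_Suc)
  also have "\<dots> = (\<Sum>i<n. s (l i) (?S i))"
    using jp by (subst (2) sum.remove[of _ j]) (auto simp del: sum.lessThan_Suc)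
  finally show "translate s j p (linform_mult s n l T) k = linform_mult s n (l(p := l p + l j)) ?P k"
    using L by simp
qed

lemma translate_linform_mults:
  assumes "j \<noteq> p" "j < n" "p < n" "truncated j p T"
  shows "translate s j p (linform_mults s n ls T) = linform_mults s n (map (\<lambda>l. l(p := l p + l j)) ls) (translate s j p T)"
  using assms by (induction ls) (simp_all add: translate_linform_mult truncated_linform_mults)

text \<open>Along the antidiagonal the mode of x_p only grows, so it stays in the range where
  \<open>T\<close> vanishes; for x_j, the terms outside that range have coefficient 0.\<close>

lemma regular_translate:
  assumes "j \<noteq> p" "regular i T" "i = j \<or> i = p"
  shows "regular i (translate s j p T)"
  unfolding regular_def translate_def
proof (intro allI impI sum.neutral ballI)
  fix k m assume k: "k i \<ge> 0" and m: "m \<in> {m. T (antidiagonal j p m k) \<noteq> 0}"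
  then have "antidiagonal j p m k i < 0" using assms(2) by (auto simp: regular_def not_le[symmetric])
  then have "i = j" "k j - int m < 0" using assms k by auto
  then show "s (translate_coef (k j) m) (T (antidiagonal j p m k)) = 0"
    using k by (simp add: translate_coef_eq_0)
qed

text \<open>Restricted to negative powers of x_i, the substitution is unitriangular along every antidiagonal.\<close>

lemma regular_of_translate:
  assumes jp: "j \<noteq> p" and T: "truncated j p T" and i: "i \<noteq> p" and R: "regular i (translate s j p T)"
  shows "regular i T"
  unfolding regular_def
proof (intro allI impI, rule ccontr)
  fix k assume k: "0 \<le> k i" "T k \<noteq> 0"
  let ?Q = "\<lambda>m. T (antidiagonal j p m k) \<noteq> 0 \<and> antidiagonal j p m k i \<ge> 0"
  obtain B where B: "\<And>m. m \<ge> B \<Longrightarrow> T (antidiagonal j p m k) = 0" using T by (auto simp: truncated_def)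
  have Q0: "?Q 0" using k by simp
  have bd: "\<forall>m. ?Q m \<longrightarrow> m \<le> B" using B nat_le_linear by blast
  \<comment> \<open>At the last mode of the antidiagonal that violates regularity, the translate
    reduces to its leading term \<open>T ?k\<close>. Later terms vanish by maximality or, if i = j
    and the mode has become negative, by \<open>translate_coef_eq_0\<close>.\<close>
  define m where "m = (GREATEST m. ?Q m)"
  have Qm: "?Q m" unfolding m_def by (rule GreatestI_nat[of ?Q, OF Q0]) (use bd in blast)
  have mx: "m' \<le> m" if "?Q m'" for m' unfolding m_def using that
    by (intro Greatest_le_nat[of ?Q _ B]) (use bd in blast)+
  let ?k = "antidiagonal j p m k"
  have z: "s (translate_coef (?k j) m') (T (antidiagonal j p m' ?k)) = 0" if "m' > 0" for m'
  proof (cases "antidiagonal j p m' ?k i \<ge> 0")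
    case True
    then have "T (antidiagonal j p m' ?k) = 0" using mx[of "m' + m"] that by (auto simp: antidiagonal_antidiagonal[OF jp])
    then show ?thesis by simp
  next
    case False
    then have "i = j" using Qm i antidiagonal_other[of i j p m' ?k] by fastforce
    then have "translate_coef (?k j) m' = 0" using Qm False jp by (intro translate_coef_eq_0) auto
    then show ?thesis by simp
  qed
  have "translate s j p T ?k = (\<Sum>m'<Suc B. s (translate_coef (?k j) m') (T (antidiagonal j p m' ?k)))"
    by (rule translate_eq) (simp add: antidiagonal_antidiagonal[OF jp] B)
  also have "\<dots> = T ?k"
    unfolding sum.lessThan_Suc_shift using z by (simp add: sum.neutral)
  finally have "translate s j p T ?k \<noteq> 0" using Qm by simp
  moreover have "translate s j p T ?k = 0" using R Qm unfolding regular_def by blast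
  ultimately show False by simp
qed

lemma linform_mult_binary:
  assumes "i < n" "j < n" "i \<noteq> j"
  shows "linform_mult s n (\<lambda>m. xvar i m + c * xvar j m) T k = T (k(i := k i + 1)) + s c (T (k(j := k j + 1)))"
proof -
  have "linform_mult s n (\<lambda>m. xvar i m + c * xvar j m) T k =
    (\<Sum>m<n. (if m = i then T (k(i := k i + 1)) else 0) + (if m = j then s c (T (k(j := k j + 1))) else 0))"
    unfolding linform_mult_def using assms(3) by (intro sum.cong) (auto simp: xvar_def)
  then show ?thesis using assms by (simp add: sum.distrib)
qed

lemma linform_mults_replicate_binary:
  assumes "i < n" "j < n" "i \<noteq> j"
  shows "linform_mults s n (replicate r (\<lambda>m. xvar i m + xvar j m)) T k =
    (\<Sum>m\<le>r. s (of_nat (r choose m)) (T (k(i := k i + int r - int m, j := k j + int m))))"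
proof (induction r arbitrary: k)
  case (Suc r)
  let ?K = "\<lambda>m. k(i := k i + int (Suc r) - int m, j := k j + int m)"
  have e: "linform_mult s n (\<lambda>m. xvar i m + xvar j m) T k = T (k(i := k i + 1)) + T (k(j := k j + 1))" for T k
    using linform_mult_binary[OF assms, where c = 1] by simp
  have "linform_mults s n (replicate (Suc r) (\<lambda>m. xvar i m + xvar j m)) T k =
     (\<Sum>m\<le>r. s (of_nat (r choose m)) (T (?K m))) + (\<Sum>m\<le>r. s (of_nat (r choose m)) (T (?K (Suc m))))"
    unfolding replicate_Suc linform_mults_simps e Suc using assms
    by (intro arg_cong2[where f = "(+)"] sum.cong refl arg_cong2[where f = s] arg_cong[where f = T])
       (auto simp: fun_eq_iff)
  also have "(\<Sum>m\<le>r. s (of_nat (r choose m)) (T (?K m))) = (\<Sum>m\<le>Suc r. s (of_nat (r choose m)) (T (?K m)))"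
    by (simp add: binomial_eq_0)
  also have "\<dots> = T (?K 0) + (\<Sum>m\<le>r. s (of_nat (r choose Suc m)) (T (?K (Suc m))))"
    by (subst sum.atMost_Suc_shift) (simp del: sum.atMost_Suc)
  also have "T (?K 0) + (\<Sum>m\<le>r. s (of_nat (r choose Suc m)) (T (?K (Suc m)))) +
      (\<Sum>m\<le>r. s (of_nat (r choose m)) (T (?K (Suc m)))) =
      T (?K 0) + (\<Sum>m\<le>r. s (of_nat (Suc r choose Suc m)) (T (?K (Suc m))))"
    by (simp add: sum.distrib[symmetric] scale_left_distrib add.assoc add.commute)
  also have "\<dots> = (\<Sum>m\<le>Suc r. s (of_nat (Suc r choose m)) (T (?K m)))"
    unfolding sum.atMost_Suc_shift by simp
  finally show ?case .
qed simp

end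

lemma linear_linform_mult:
  assumes "Vector_Spaces.linear s s' f"
  shows "f (linform_mult s n l T k) = linform_mult s' n l (\<lambda>k. f (T k)) k"
proof -
  interpret Vector_Spaces.linear s s' f by fact
  show ?thesis by (simp add: linform_mult_def sum scale)
qed

lemma linear_linform_mults:
  assumes "Vector_Spaces.linear s s' f"
  shows "f (linform_mults s n ls T k) = linform_mults s' n ls (\<lambda>k. f (T k)) k"
  by (induction ls arbitrary: k) (simp_all add: linear_linform_mult[OF assms])

section \<open>Laurent series of complex variables\<close>

definition mode_monomial :: "nat \<Rightarrow> (nat \<Rightarrow> complex) \<Rightarrow> (nat \<Rightarrow> int) \<Rightarrow> complex" where
  "mode_monomial n z k = (\<Prod>i<n. z i powi (- k i - 1))"

lemma mode_monomial_bump: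
  assumes "i < n" "z i \<noteq> 0"
  shows "mode_monomial n z (k(i := k i + d)) = mode_monomial n z k * z i powi (- d)"
proof -
  have "mode_monomial n z (k(i := k i + d)) = z i powi (- k i - 1 - d) * (\<Prod>j\<in>{..<n}-{i}. z j powi (- k j - 1))"
    unfolding mode_monomial_def using assms by (subst prod.remove[of _ i]) (auto intro!: arg_cong2[where f = "(*)"] arg_cong2[where f = "(powi)"])
  also have "z i powi (- k i - 1 - d) = z i powi (- k i - 1) * z i powi (- d)"
    using assms power_int_add[of "z i" "- k i - 1" "- d"] by simp
  also have "z i powi (- k i - 1) * z i powi (- d) * (\<Prod>j\<in>{..<n}-{i}. z j powi (- k j - 1)) =
      (\<Prod>j<n. z j powi (- k j - 1)) * z i powi (- d)"
    using assms by (subst (2) prod.remove[of _ i]) (auto simp: mult_ac)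
  finally show ?thesis by (simp add: mode_monomial_def)
qed

lemma idx_upd: "k \<in> idx n \<Longrightarrow> i < n \<Longrightarrow> k(i := d) \<in> idx n"
  by (auto simp: idx_def)

lemma antidiagonal_idx: "k \<in> idx n \<Longrightarrow> i < n \<Longrightarrow> j < n \<Longrightarrow> antidiagonal i j m k \<in> idx n"
  by (auto simp: idx_def antidiagonal_def)

lemma mode_monomial_antidiagonal:
  assumes "i < n" "j < n" "i \<noteq> j" "z i \<noteq> 0" "z j \<noteq> 0"
  shows "mode_monomial n z (antidiagonal i j m k) = mode_monomial n z k * z i ^ m / z j ^ m"
proof -
  have "antidiagonal i j m k = (k(i := k i + (- int m)))(j := (k(i := k i + (- int m))) j + int m)"
    using assms by (auto simp: antidiagonal_def fun_eq_iff)
  then have "mode_monomial n z (antidiagonal i j m k) = mode_monomial n z k * z i powi int m * z j powi (- int m)"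
    using assms mode_monomial_bump[of i n z k "- int m"] mode_monomial_bump[of j n z "k(i := k i + (- int m))" "int m"]
    by simp
  then show ?thesis by (simp add: power_int_minus field_simps)
qed

lemma has_sum_bump_iff:
  assumes "i < n" "z i \<noteq> 0"
  shows "((\<lambda>k. A (k(i := k i + 1)) * mode_monomial n z k) has_sum R * z i) (idx n) \<longleftrightarrow>
         ((\<lambda>k. A k * mode_monomial n z k) has_sum R) (idx n)"
proof -
  have b: "bij_betw (\<lambda>k. k(i := k i + 1)) (idx n) (idx n)"
    by (rule bij_betwI[of _ _ _ "\<lambda>k. k(i := k i - 1)"]) (use assms in \<open>auto intro: idx_upd\<close>)
  have e: "A (k(i := k i + 1)) * mode_monomial n z k = A (k(i := k i + 1)) * mode_monomial n z (k(i := k i + 1)) * z i" for k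
    using mode_monomial_bump[of i n z k 1] assms by (simp add: power_int_minus)
  have "((\<lambda>k. A (k(i := k i + 1)) * mode_monomial n z k) has_sum R * z i) (idx n) \<longleftrightarrow>
        ((\<lambda>k. A (k(i := k i + 1)) * mode_monomial n z (k(i := k i + 1)) * z i) has_sum R * z i) (idx n)"
    by (simp only: e)
  also have "\<dots> \<longleftrightarrow> ((\<lambda>k. A k * mode_monomial n z k * z i) has_sum R * z i) (idx n)"
    by (rule has_sum_reindex_bij_betw[OF b, of "\<lambda>k. A k * mode_monomial n z k * z i"])
  also have "\<dots> \<longleftrightarrow> ((\<lambda>k. A k * mode_monomial n z k) has_sum R) (idx n)"
  proof
    assume "((\<lambda>k. A k * mode_monomial n z k * z i) has_sum R * z i) (idx n)"
    from has_sum_cmult_left[OF this, of "inverse (z i)"]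
    show "((\<lambda>k. A k * mode_monomial n z k) has_sum R) (idx n)"
      using assms by (simp add: mult.assoc)
  qed (rule has_sum_cmult_left)
  finally show ?thesis .
qed

lemma has_sum_finite_sum:
  fixes f :: "'a \<Rightarrow> 'b \<Rightarrow> 'c :: topological_comm_monoid_add"
  assumes "\<And>i. i \<in> I \<Longrightarrow> (f i has_sum s i) A"
  shows "((\<lambda>x. \<Sum>i\<in>I. f i x) has_sum (\<Sum>i\<in>I. s i)) A"
  using assms by (induction I rule: infinite_finite_induct) (auto intro: has_sum_add)

lemma has_sum_linform_mult:
  assumes "\<And>i. i < n \<Longrightarrow> z i \<noteq> 0" "((\<lambda>k. A k * mode_monomial n z k) has_sum R) (idx n)"
  shows "((\<lambda>k. linform_mult (*) n l A k * mode_monomial n z k) has_sum (\<Sum>i<n. l i * z i) * R) (idx n)"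
proof -
  have "((\<lambda>k. \<Sum>i<n. l i * (A (k(i := k i + 1)) * mode_monomial n z k)) has_sum (\<Sum>i<n. l i * (R * z i))) (idx n)"
    by (intro has_sum_finite_sum has_sum_cmult_right has_sum_bump_iff[THEN iffD2]) (use assms in auto)
  then show ?thesis by (simp add: linform_mult_def sum_distrib_left sum_distrib_right mult_ac)
qed

lemma has_sum_linform_mults:
  assumes "\<And>i. i < n \<Longrightarrow> z i \<noteq> 0" "((\<lambda>k. A k * mode_monomial n z k) has_sum R) (idx n)"
  shows "((\<lambda>k. linform_mults (*) n ls A k * mode_monomial n z k) has_sum (\<Prod>l\<leftarrow>ls. \<Sum>i<n. l i * z i) * R) (idx n)"
proof (induction ls)
  case (Cons l ls)
  show ?case using has_sum_linform_mult[OF assms(1) Cons, of l] by (simp add: mult.assoc)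
qed (use assms in simp)

lemma complex_vector_space_complex: "complex_vector_space ((*) :: complex \<Rightarrow> complex \<Rightarrow> complex)"
  unfolding complex_vector_space_def by unfold_locales (auto simp: algebra_simps)

text \<open>The known sum is multiplied by the series of z_j^m / z_i^(m+1), which converges
  absolutely to 1/(z_i - z_j), and the double sum is regrouped by monomials. The coefficient of each
  monomial telescopes, and truncation removes the remote end. Summability of the series of
  \<open>A\<close> is thereby a result.\<close>

lemma has_sum_xdiff_cancel:
  assumes ij: "i < n" "j < n" "i \<noteq> j" and z: "z j \<noteq> 0" "norm (z j) < norm (z i)"
    and tr: "truncated i j A"
    and S: "((\<lambda>k. linform_mult (*) n (xdiff i j) A k * mode_monomial n z k) has_sum R) (idx n)"
  shows "((\<lambda>k. A k * mode_monomial n z k) has_sum R / (z i - z j)) (idx n)"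
proof -
  interpret complex_vector_space "(*) :: complex \<Rightarrow> complex \<Rightarrow> complex" by (rule complex_vector_space_complex)
  have zi: "z i \<noteq> 0" using z by auto
  define B where "B = linform_mult (*) n (xdiff i j) A"
  have xd: "xdiff i j = (\<lambda>m. xvar i m + (- 1) * xvar j m)" by (auto simp: xdiff_def)
  have B: "B k = A (k(i := k i + 1)) - A (k(j := k j + 1))" for k
    unfolding B_def xd using linform_mult_binary[OF ij, of "-1" A k] by simp
  define q where "q = (\<lambda>m. z j ^ m / z i ^ Suc m)"
  have q': "q = (\<lambda>m. inverse (z i) * (z j / z i) ^ m)"
    by (auto simp: q_def fun_eq_iff field_simps)
  have nq: "norm (z j / z i) < 1" using z zi by (simp add: norm_divide)
  have q: "(q has_sum 1 / (z i - z j)) UNIV"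
  proof -
    have "(\<lambda>m. norm (z j / z i) ^ m) sums (1 / (1 - norm (z j / z i)))"
      using nq by (intro geometric_sums) simp
    then have "summable (\<lambda>m. norm (q m))"
      unfolding q' by (auto simp: norm_mult norm_power intro: summable_mult dest: sums_summable)
    moreover have "q sums (inverse (z i) * (1 / (1 - z j / z i)))"
      unfolding q' by (intro sums_mult geometric_sums nq)
    ultimately have "(q has_sum (inverse (z i) * (1 / (1 - z j / z i)))) UNIV"
      by (intro norm_summable_imp_has_sum)
    also have "inverse (z i) * (1 / (1 - z j / z i)) = 1 / (z i - z j)"
      using zi by (simp add: field_simps)
    finally show ?thesis .
  qed
  define F where "F = (\<lambda>(l, m). (B l * mode_monomial n z l) * q m)"
  have F: "(F has_sum (R / (z i - z j))) (idx n \<times> UNIV)"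
  proof (rule has_sum_SigmaI)
    show "((\<lambda>m. F (l, m)) has_sum (B l * mode_monomial n z l * (1 / (z i - z j)))) UNIV" for l
      unfolding F_def prod.case by (intro has_sum_cmult_right q)
    show "((\<lambda>l. B l * mode_monomial n z l * (1 / (z i - z j))) has_sum (R / (z i - z j))) (idx n)"
      using has_sum_cmult_left[OF S, of "1 / (z i - z j)"] by (simp add: B_def)
    have 1: "(\<lambda>l. norm (B l * mode_monomial n z l)) summable_on idx n"
      using has_sum_imp_summable[OF S] unfolding B_def summable_on_iff_abs_summable_on_complex .
    have 2: "(\<lambda>m. norm (q m)) summable_on UNIV"
      using has_sum_imp_summable[OF q] unfolding summable_on_iff_abs_summable_on_complex .
    show "F summable_on idx n \<times> UNIV"
      unfolding summable_on_iff_abs_summable_on_complex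
    proof (rule summable_on_SigmaI)
      show "((\<lambda>m. norm (F (l, m))) has_sum (norm (B l * mode_monomial n z l) * (\<Sum>\<^sub>\<infinity>m. norm (q m)))) UNIV" for l
        unfolding F_def prod.case norm_mult[of _ "q _"]
        by (intro has_sum_cmult_right has_sum_infsum 2)
    qed (auto intro: summable_on_cmult_left 1)
  qed
  \<comment> \<open>The first component is the mode whose monomial, multiplied by the m-th geometric
    term, gives the monomial of mode \<open>k\<close>.\<close>
  define g where "g = (\<lambda>(k, m). ((antidiagonal i j m k)(i := antidiagonal i j m k i - 1), m))"
  have g: "bij_betw g (idx n \<times> UNIV) (idx n \<times> UNIV)"
  proof (rule bij_betwI[of _ _ _ "\<lambda>(k, m). (k(i := k i + int m + 1, j := k j - int m), m)"])
    show "g \<in> idx n \<times> UNIV \<rightarrow> idx n \<times> UNIV"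
      using ij by (auto simp: g_def intro!: idx_upd antidiagonal_idx)
    show "(\<lambda>(k, m). (k(i := k i + int m + 1, j := k j - int m), m)) \<in> idx n \<times> UNIV \<rightarrow> idx n \<times> UNIV"
      using ij by (auto intro!: idx_upd)
  qed (use ij in \<open>auto simp: g_def antidiagonal_def fun_eq_iff\<close>)
  have Fg: "F (g (k, m)) = (A (antidiagonal i j m k) - A (antidiagonal i j (Suc m) k)) * mode_monomial n z k" for k m
  proof -
    let ?l = "(antidiagonal i j m k)(i := antidiagonal i j m k i - 1)"
    have 1: "?l(i := ?l i + 1) = antidiagonal i j m k" "?l(j := ?l j + 1) = antidiagonal i j (Suc m) k"
      using ij by (auto simp: antidiagonal_def fun_eq_iff)
    have "mode_monomial n z (antidiagonal i j m k) = mode_monomial n z ?l * z i powi (-1)"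
      using mode_monomial_bump[of i n z ?l 1] ij zi unfolding 1 by blast
    then have "mode_monomial n z ?l = mode_monomial n z (antidiagonal i j m k) * z i"
      using zi by (simp add: power_int_minus)
    also have "\<dots> = mode_monomial n z k * z i ^ Suc m / z j ^ m"
      using ij zi z by (simp add: mode_monomial_antidiagonal)
    finally have "mode_monomial n z ?l * q m = mode_monomial n z k"
      using zi z by (simp add: q_def)
    then show ?thesis unfolding F_def g_def prod.case B 1 by simp
  qed
  have "((\<lambda>x. F (g x)) has_sum (R / (z i - z j))) (idx n \<times> UNIV)"
    using F has_sum_reindex_bij_betw[OF g] by blast
  then show ?thesis
  proof (rule has_sum_SigmaD)
    fix k
    obtain M where M: "\<And>m. m \<ge> M \<Longrightarrow> A (antidiagonal i j m k) = 0" using tr by (auto simp: truncated_def)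
    show "((\<lambda>m. F (g (k, m))) has_sum A k * mode_monomial n z k) UNIV"
    proof (rule has_sum_finite_neutralI[of "{..<M}"])
      have "(\<Sum>m<M. F (g (k, m))) = (\<Sum>m<M. A (antidiagonal i j m k) - A (antidiagonal i j (Suc m) k)) * mode_monomial n z k"
        unfolding Fg by (simp add: sum_distrib_right)
      also have "\<dots> = A k * mode_monomial n z k"
        using M sum_lessThan_telescope'[of "\<lambda>m. A (antidiagonal i j m k)" M] by simp
      finally show "A k * mode_monomial n z k = (\<Sum>m<M. F (g (k, m)))" by simp
    qed (auto simp: Fg M)
  qed
qed

section \<open>Uniqueness of Laurent expansions on real points\<close>

text \<open>A bound on the modes means a finite principal part, so a power of x turns the series
  into a power series. Its coefficients vanish one after the other: once the earlier ones are 0,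
  dividing by x^n leaves a series whose limit at 0 from the right is both its constant term and
  0.\<close>

lemma laurent_series_unique:
  fixes C :: "int \<Rightarrow> complex"
  assumes c: "\<And>a. a \<ge> c \<Longrightarrow> C a = 0" and r: "r > 0"
    and S: "\<And>x. 0 < x \<Longrightarrow> x < r \<Longrightarrow> ((\<lambda>a. C a * of_real x powi (- a - 1)) has_sum 0) UNIV"
  shows "C a = 0"
proof -
  \<comment> \<open>Mode c - 1 - n belongs to the power x^(n - c), so \<open>b\<close> lists the
    coefficients after multiplication by x^c.\<close>
  define b where "b = (\<lambda>n. C (c - 1 - int n))"
  have b0: "(\<lambda>n. b n * of_real x ^ n) sums 0" if x: "0 < x" "x < r" for x
  proof -
    have "((\<lambda>a. C a * of_real x powi (- a - 1)) has_sum 0) {..<c}"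
      using S[OF x] by (rule has_sum_cong_neutral[THEN iffD1, rotated -1]) (use c in auto)
    moreover have "bij_betw (\<lambda>n. c - 1 - int n) UNIV {..<c}"
      by (rule bij_betwI[of _ _ _ "\<lambda>a. nat (c - 1 - a)"]) auto
    ultimately have "((\<lambda>n. C (c - 1 - int n) * of_real x powi (- (c - 1 - int n) - 1)) has_sum 0) UNIV"
      using has_sum_reindex_bij_betw[of _ UNIV "{..<c}" "\<lambda>a. C a * of_real x powi (- a - 1)"] by blast
    from has_sum_imp_sums[OF has_sum_cmult_left[OF this, of "of_real x powi c"]]
    have "(\<lambda>n. b n * (of_real x powi (- (c - 1 - int n) - 1) * of_real x powi c)) sums 0"
      by (simp add: b_def mult.assoc)
    moreover have "of_real x powi (- (c - 1 - int n) - 1) * of_real x powi c = (of_real x ^ n :: complex)" for n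
      using x by (subst power_int_add[symmetric]) auto
    ultimately show ?thesis by simp
  qed
  have "b n = 0" for n
  proof (induction n rule: less_induct)
    case (less n)
    have s: "(\<lambda>m. b (m + n) * of_real x ^ m) sums 0" if x: "0 < x" "x < r" for x
    proof -
      have "(\<lambda>m. b (m + n) * of_real x ^ (m + n)) sums 0"
        using sums_split_initial_segment[OF b0[OF x], of n] less by simp
      from sums_mult2[OF this, of "inverse (of_real x ^ n)"] show ?thesis
        using x by (simp add: power_add mult.assoc)
    qed
    define f where "f = (\<lambda>z. \<Sum>m. b (m + n) * z ^ m)"
    have "(f \<longlongrightarrow> b (0 + n)) (at 0)"
    proof (rule powser_limit_0[of "r / 2"])
      fix z :: complex assume z: "norm z < r / 2"
      have "summable (\<lambda>m. b (m + n) * of_real (r / 2) ^ m)"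
        using s[of "r / 2"] r by (auto dest: sums_summable)
      then have "summable (\<lambda>m. b (m + n) * z ^ m)"
        by (rule powser_inside) (use z r in simp)
      then show "(\<lambda>m. b (m + n) * z ^ m) sums f z"
        unfolding f_def by (rule summable_sums)
    qed (use r in simp)
    moreover have "filterlim complex_of_real (at 0) (at_right 0)"
      unfolding filterlim_at by (auto intro!: tendsto_eq_intros simp: eventually_at_filter)
    ultimately have "((\<lambda>x. f (complex_of_real x)) \<longlongrightarrow> b (0 + n)) (at_right 0)"
      by (rule filterlim_compose)
    moreover have "eventually (\<lambda>x. f (complex_of_real x) = 0) (at_right 0)"
      unfolding eventually_at_right_field
      by (intro exI[of _ r]) (use r s in \<open>auto simp: f_def sums_unique[symmetric]\<close>)
    then have "((\<lambda>x. f (complex_of_real x)) \<longlongrightarrow> 0) (at_right 0)"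
      by (rule tendsto_eventually)
    ultimately have "b (0 + n) = 0"
      by (intro tendsto_unique[of "at_right (0::real)"]) auto
    then show ?case by simp
  qed
  then have "C a = 0" if "a < c"
    using that b_def[THEN fun_cong, of "nat (c - 1 - a)"] by simp
  then show ?thesis using c by force
qed

text \<open>The modes b have a uniform bound, the modes a only one for each b. Hence x is fixed
  first: the row sums are the coefficients of a Laurent series in y on (0, x) and vanish. Each row
  is then a Laurent series in x alone, to which the bound for its own b applies.\<close>

lemma laurent_series_unique2:
  fixes C :: "int \<Rightarrow> int \<Rightarrow> complex"
  assumes c: "\<And>a b. b \<ge> c \<Longrightarrow> C a b = 0" and c': "\<And>b. \<exists>c'. \<forall>a\<ge>c'. C a b = 0"
    and S: "\<And>x y. 0 < y \<Longrightarrow> y < x \<Longrightarrow>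
      ((\<lambda>(a, b). C a b * of_real x powi (- a - 1) * of_real y powi (- b - 1)) has_sum 0) (UNIV \<times> UNIV)"
  shows "C a b = 0"
proof -
  define X where "X = (\<lambda>(x::real) a. complex_of_real x powi (- a - 1))"
  have X0: "X x a \<noteq> 0" if "x > 0" for x a using that by (simp add: X_def)
  have S': "((\<lambda>(b, a). C a b * X x a * X y b) has_sum 0) (UNIV \<times> UNIV)" if "0 < y" "y < x" for x y
    using S[OF that] by (subst (asm) has_sum_swap) (simp add: case_prod_unfold X_def)
  \<comment> \<open>The second variable may be fixed at x/2, a point of (0, x), and its nonzero
    power divided out.\<close>
  have row: "(\<lambda>a. C a b * X x a) summable_on UNIV" if x: "x > 0" for x b
  proof -
    have "(\<lambda>a. C a b * X x a * X (x/2) b) summable_on UNIV"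
      using summable_on_SigmaD1[of "\<lambda>b a. C a b * X x a * X (x/2) b" UNIV "\<lambda>_. UNIV" b]
        has_sum_imp_summable[OF S'[of "x/2" x]] x by simp
    from summable_on_cmult_left[OF this, of "inverse (X (x/2) b)"] show ?thesis
      using X0[of "x/2" b] x by (simp add: mult.assoc)
  qed
  define G where "G = (\<lambda>x b. \<Sum>\<^sub>\<infinity>a. C a b * X x a)"
  have hG: "((\<lambda>a. C a b * X x a) has_sum G x b) UNIV" if "x > 0" for x b
    unfolding G_def using row[OF that] by (rule has_sum_infsum)
  have "G x b = 0" if x: "x > 0" for x b
  proof (rule laurent_series_unique[of c "G x"])
    show "G x b = 0" if "b \<ge> c" for b using that c by (simp add: G_def)
    show "((\<lambda>b. G x b * of_real y powi (- b - 1)) has_sum 0) UNIV" if y: "0 < y" "y < x" for y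
    proof (rule has_sum_SigmaD[OF S'[OF y]])
      show "((\<lambda>a. case (b, a) of (b, a) \<Rightarrow> C a b * X x a * X y b) has_sum G x b * of_real y powi (- b - 1)) UNIV" for b
        using has_sum_cmult_left[OF hG[OF x, of b], of "X y b"] by (simp add: X_def)
    qed
  qed (rule x)
  then have "((\<lambda>a. C a b * of_real x powi (- a - 1)) has_sum 0) UNIV" if "x > 0" for x
    using hG[OF that, of b] that by (simp add: X_def)
  moreover obtain c1 where "\<And>a. a \<ge> c1 \<Longrightarrow> C a b = 0" using c'[of b] by blast
  ultimately show ?thesis
    using laurent_series_unique[of c1 "\<lambda>a. C a b" 1] by simp
qed

text \<open>In the uniqueness statements \<open>p\<close> is the position of the larger variable: 0
  for products, 1 for iterates. The default 0 beyond the first two positions puts integer-valued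
  instances into \<open>idx 2\<close>.\<close>

definition vec2 :: "nat \<Rightarrow> 'a::zero \<Rightarrow> 'a \<Rightarrow> nat \<Rightarrow> 'a" where
  "vec2 p a b = (\<lambda>i. if i < 2 then if i = p then a else b else 0)"

lemma laurent_series_unique_idx2:
  fixes C :: "(nat \<Rightarrow> int) \<Rightarrow> complex"
  assumes pq: "p < 2" "q < 2" "p \<noteq> q"
    and c: "\<And>k. k q \<ge> c \<Longrightarrow> C k = 0" and c': "\<And>b. \<exists>c'. \<forall>k. k q = b \<longrightarrow> k p \<ge> c' \<longrightarrow> C k = 0"
    and S: "\<And>x y. 0 < y \<Longrightarrow> y < x \<Longrightarrow>
      ((\<lambda>k. C k * mode_monomial 2 (vec2 p (of_real x) (of_real y)) k) has_sum 0) (idx 2)"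
    and k: "k \<in> idx 2"
  shows "C k = 0"
proof -
  have i2: "i < 2 \<longleftrightarrow> i = p \<or> i = q" for i using pq by auto
  have s2: "{..<2} = {p, q}" using i2 by auto
  have e: "vec2 p (k p) (k q) = k" if "k \<in> idx 2" for k :: "nat \<Rightarrow> int"
    using that pq i2 by (auto simp: vec2_def idx_def fun_eq_iff not_less[symmetric])
  have bij: "bij_betw (\<lambda>(a, b). vec2 p a b) (UNIV \<times> UNIV) (idx 2)"
    by (rule bij_betwI[of _ _ _ "\<lambda>k. (k p, k q)"]) (use pq e in \<open>auto simp: vec2_def idx_def\<close>)
  have "C (vec2 p (k p) (k q)) = 0"
  proof (rule laurent_series_unique2[of c "\<lambda>a b. C (vec2 p a b)"])
    show "\<exists>c'. \<forall>a\<ge>c'. C (vec2 p a b) = 0" for b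
    proof -
      obtain d where "\<And>k. k q = b \<Longrightarrow> k p \<ge> d \<Longrightarrow> C k = 0" using c' by blast
      then show ?thesis using pq by (intro exI[of _ d]) (auto simp: vec2_def)
    qed
    show "C (vec2 p a b) = 0" if "b \<ge> c" for a b
      using that pq by (intro c) (auto simp: vec2_def)
    show "((\<lambda>(a, b). C (vec2 p a b) * of_real x powi (- a - 1) * of_real y powi (- b - 1)) has_sum 0) (UNIV \<times> UNIV)"
      if "0 < y" "y < x" for x y
    proof -
      have "mode_monomial 2 (vec2 p (of_real x) (of_real y)) (vec2 p a b) =
          of_real x powi (- a - 1) * of_real y powi (- b - 1)" for a b
        unfolding mode_monomial_def s2 using pq by (simp add: vec2_def)
      then show ?thesis
        using S[OF that] has_sum_reindex_bij_betw[OF bij, of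
           "\<lambda>k. C k * mode_monomial 2 (vec2 p (of_real x) (of_real y)) k" 0]
        by (simp add: case_prod_unfold mult.assoc)
    qed
  qed
  then show ?thesis using e[OF k] by simp
qed

section \<open>Polynomials as coefficient families\<close>

definition mode_of_exponent :: "nat \<Rightarrow> (nat \<Rightarrow> nat) \<Rightarrow> nat \<Rightarrow> int" where
  "mode_of_exponent n \<alpha> = (\<lambda>i. if i < n then - int (\<alpha> i) - 1 else 0)"

definition poly_modes :: "nat \<Rightarrow> ((nat \<Rightarrow> nat) \<Rightarrow> complex) \<Rightarrow> (nat \<Rightarrow> int) \<Rightarrow> complex" where
  "poly_modes n P k = (if \<forall>i<n. k i < 0 then P (\<lambda>i. if i < n then nat (- k i - 1) else 0) else 0)"

lemma mode_of_exponent_idx: "mode_of_exponent n \<alpha> \<in> idx n"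
  by (auto simp: mode_of_exponent_def idx_def)

lemma mode_of_exponent_inj: "inj_on (mode_of_exponent n) {\<alpha>. \<forall>i\<ge>n. \<alpha> i = 0}"
proof (rule inj_onI, rule ext)
  fix \<alpha> \<beta> i assume a: "\<alpha> \<in> {\<alpha>. \<forall>i\<ge>n. \<alpha> i = 0}" "\<beta> \<in> {\<alpha>. \<forall>i\<ge>n. \<alpha> i = 0}" "mode_of_exponent n \<alpha> = mode_of_exponent n \<beta>"
  then have "mode_of_exponent n \<alpha> i = mode_of_exponent n \<beta> i" by simp
  then show "\<alpha> i = \<beta> i" using a by (auto simp: mode_of_exponent_def split: if_splits)
qed

lemma poly_modes_mode_of_exponent: "\<forall>i\<ge>n. \<alpha> i = 0 \<Longrightarrow> poly_modes n P (mode_of_exponent n \<alpha>) = P \<alpha>"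
  unfolding poly_modes_def mode_of_exponent_def by (auto intro!: arg_cong[where f = P] simp: fun_eq_iff)

lemma mode_monomial_mode_of_exponent: "mode_monomial n z (mode_of_exponent n \<alpha>) = (\<Prod>i<n. z i ^ \<alpha> i)"
  by (auto simp: mode_monomial_def mode_of_exponent_def intro!: prod.cong)

lemma poly_modes_nonzero:
  assumes "k \<in> idx n" "poly_modes n P k \<noteq> 0"
  shows "\<exists>\<alpha>. P \<alpha> \<noteq> 0 \<and> (\<forall>i\<ge>n. \<alpha> i = 0) \<and> k = mode_of_exponent n \<alpha>"
  using assms by (intro exI[of _ "\<lambda>i. if i < n then nat (- k i - 1) else 0"])
    (auto simp: poly_modes_def mode_of_exponent_def idx_def fun_eq_iff split: if_splits)

lemma poly_modes_sum:
  assumes "mpoly n P"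
  shows "mpoly_eval n P z = (\<Sum>k\<in>mode_of_exponent n ` {\<alpha>. P \<alpha> \<noteq> 0}. poly_modes n P k * mode_monomial n z k)"
proof -
  have P: "\<And>\<alpha>. P \<alpha> \<noteq> 0 \<Longrightarrow> \<forall>i\<ge>n. \<alpha> i = 0" using assms by (auto simp: mpoly_def)
  then have "inj_on (mode_of_exponent n) {\<alpha>. P \<alpha> \<noteq> 0}"
    by (auto intro: inj_on_subset[OF mode_of_exponent_inj])
  then have "(\<Sum>k\<in>mode_of_exponent n ` {\<alpha>. P \<alpha> \<noteq> 0}. poly_modes n P k * mode_monomial n z k) =
      (\<Sum>\<alpha>\<in>{\<alpha>. P \<alpha> \<noteq> 0}. poly_modes n P (mode_of_exponent n \<alpha>) * mode_monomial n z (mode_of_exponent n \<alpha>))"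
    by (subst sum.reindex) (auto simp: o_def)
  also have "\<dots> = mpoly_eval n P z"
    unfolding mpoly_eval_def mode_monomial_mode_of_exponent by (intro sum.cong refl) (simp add: poly_modes_mode_of_exponent[OF P])
  finally show ?thesis by simp
qed

lemma has_sum_poly_modes:
  assumes "mpoly n P"
  shows "((\<lambda>k. poly_modes n P k * mode_monomial n z k) has_sum mpoly_eval n P z) (idx n)"
proof (rule has_sum_finite_neutralI[of "mode_of_exponent n ` {\<alpha>. P \<alpha> \<noteq> 0}"])
  show "finite (mode_of_exponent n ` {\<alpha>. P \<alpha> \<noteq> 0})" using assms by (simp add: mpoly_def)
  show "mode_of_exponent n ` {\<alpha>. P \<alpha> \<noteq> 0} \<subseteq> idx n" by (auto simp: mode_of_exponent_idx)
  show "poly_modes n P k * mode_monomial n z k = 0" if "k \<in> idx n - mode_of_exponent n ` {\<alpha>. P \<alpha> \<noteq> 0}" for k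
    using poly_modes_nonzero[of k n P] that by auto
qed (rule poly_modes_sum[OF assms])

lemma has_sum_mpoly:
  fixes A :: "(nat \<Rightarrow> int) \<Rightarrow> complex"
  assumes fin: "finite {k \<in> idx n. A k \<noteq> 0}" and R: "\<And>i. i < n \<Longrightarrow> regular i A"
  obtains P where "mpoly n P" "\<And>z. ((\<lambda>k. A k * mode_monomial n z k) has_sum mpoly_eval n P z) (idx n)"
proof -
  define P where "P = (\<lambda>\<alpha>. if \<forall>i\<ge>n. \<alpha> i = 0 then A (mode_of_exponent n \<alpha>) else 0)"
  have P0: "{\<alpha>. P \<alpha> \<noteq> 0} \<subseteq> {\<alpha>. \<forall>i\<ge>n. \<alpha> i = 0}" by (auto simp: P_def)
  have "mode_of_exponent n ` {\<alpha>. P \<alpha> \<noteq> 0} \<subseteq> {k \<in> idx n. A k \<noteq> 0}"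
    by (auto simp: P_def mode_of_exponent_idx)
  then have "finite {\<alpha>. P \<alpha> \<noteq> 0}"
    using fin finite_subset finite_imageD inj_on_subset[OF mode_of_exponent_inj P0] by meson
  then have mp: "mpoly n P" using P0 by (auto simp: mpoly_def)
  have "poly_modes n P k = A k" if k: "k \<in> idx n" for k
  proof (cases "\<forall>i<n. k i < 0")
    case True
    then have e: "mode_of_exponent n (\<lambda>i. if i < n then nat (- k i - 1) else 0) = k"
      using k by (auto simp: mode_of_exponent_def idx_def fun_eq_iff)
    have "poly_modes n P k = P (\<lambda>i. if i < n then nat (- k i - 1) else 0)"
      using True by (simp add: poly_modes_def)
    also have "\<dots> = A k" unfolding P_def using e by simp
    finally show ?thesis .
  next
    case False
    then obtain i where "i < n" "k i \<ge> 0" by (auto simp: not_less)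
    then have "A k = 0" using R by (auto simp: regular_def)
    then show ?thesis using False by (auto simp: poly_modes_def)
  qed
  then have "((\<lambda>k. A k * mode_monomial n z k) has_sum mpoly_eval n P z) (idx n)" for z
    using has_sum_poly_modes[OF mp, of z] by (simp cong: has_sum_cong)
  then show ?thesis using that mp by blast
qed

text \<open>The power x_j^a has mode - a - 1, and its part with x_p^m lands at mode m - a - 1: this
  is the ordinary binomial expansion of (x_j + x_p)^a.\<close>

lemma translate_coef_binomial: "translate_coef (int m - int a - 1) m = of_nat (a choose m)"
proof -
  have "(of_nat a gchoose m :: complex) = (-1) ^ m * ((of_nat m - of_nat a - 1) gchoose m)"
    by (rule gbinomial_negated_upper)
  then show ?thesis by (simp add: translate_coef_def binomial_gbinomial)
qed

text \<open>For polynomials the formal substitution is the actual one: variable 0 carries the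
  difference y, variable 1 carries x, and the value is taken at (x + y, x). The binomial theorem
  gives this for each source monomial, and regrouping by target monomial gives the
  translate.\<close>

lemma has_sum_translate_poly_modes:
  assumes P: "mpoly 2 P" and xy: "x \<noteq> 0" "y \<noteq> (0::complex)"
  shows "((\<lambda>k. translate (*) 0 1 (poly_modes 2 P) k * mode_monomial 2 (vec2 0 y x) k) has_sum
            mpoly_eval 2 P (vec2 0 (x + y) x)) (idx 2)"
proof -
  let ?z = "vec2 0 y x" and ?p = "poly_modes 2 P"
  interpret complex_vector_space "(*) :: complex \<Rightarrow> complex \<Rightarrow> complex" by (rule complex_vector_space_complex)
  define F where "F = (\<lambda>(l, m). ?p l * translate_coef (l 0 + int m) m * mode_monomial 2 ?z l * (x ^ m / y ^ m))"
  define S where "S = mode_of_exponent 2 ` {\<alpha>. P \<alpha> \<noteq> 0}"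
  have S: "finite S" "S \<subseteq> idx 2" using P by (auto simp: S_def mode_of_exponent_idx mpoly_def)
  have zm: "mode_monomial 2 z k = z 0 powi (- k 0 - 1) * z 1 powi (- k 1 - 1)" for z k
    by (simp add: mode_monomial_def numeral_2_eq_2)
  have "(F has_sum mpoly_eval 2 P (vec2 0 (x + y) x)) (idx 2 \<times> UNIV)"
  proof (rule has_sum_finite_neutralI[of "SIGMA l:S. {..nat (- l 0 - 1)}"])
    show "F lm = 0" if lm: "lm \<in> idx 2 \<times> UNIV - (SIGMA l:S. {..nat (- l 0 - 1)})" for lm
    proof -
      obtain l m where [simp]: "lm = (l, m)" by (cases lm)
      show ?thesis
      proof (cases "?p l = 0")
        case False
        then have "l \<in> S" "l 0 < 0"
          using poly_modes_nonzero[of l 2 P] lm by (auto simp: S_def poly_modes_def split: if_splits)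
        then have "translate_coef (l 0 + int m) m = 0"
          using lm by (intro translate_coef_eq_0) auto
        then show ?thesis by (simp add: F_def)
      qed (simp add: F_def)
    qed
    have "(\<Sum>m\<le>nat (- l 0 - 1). F (l, m)) = ?p l * mode_monomial 2 (vec2 0 (x + y) x) l" if "l \<in> S" for l :: "nat \<Rightarrow> int"
    proof -
      obtain \<alpha> where l: "l = mode_of_exponent 2 \<alpha>" using \<open>l \<in> S\<close> unfolding S_def by blast
      define a where "a = \<alpha> 0"
      have l0: "l 0 = - int a - 1" by (simp add: l mode_of_exponent_def a_def)
      then have na: "nat (- l 0 - 1) = a" by simp
      have pc: "translate_coef (l 0 + int m) m = of_nat (a choose m)" for m
        unfolding l0 using translate_coef_binomial[of m a] by (simp add: algebra_simps)
      have "(\<Sum>m\<le>a. F (l, m)) = ?p l * x powi (- l 1 - 1) * (\<Sum>m\<le>a. of_nat (a choose m) * x ^ m * y ^ (a - m))"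
        unfolding sum_distrib_left
      proof (rule sum.cong)
        fix m assume "m \<in> {..a}"
        then have "y ^ a * (x ^ m / y ^ m) = x ^ m * y ^ (a - m)"
          using xy by (simp add: power_diff)
        from arg_cong[OF this, of "\<lambda>t. ?p l * of_nat (a choose m) * x powi (- l 1 - 1) * t"]
        show "F (l, m) = ?p l * x powi (- l 1 - 1) * (of_nat (a choose m) * x ^ m * y ^ (a - m))"
          unfolding F_def prod.case pc zm by (simp add: l0 vec2_def mult_ac del: times_divide_eq_right times_divide_eq_left)
      qed simp
      also have "(\<Sum>m\<le>a. of_nat (a choose m) * x ^ m * y ^ (a - m)) = (x + y) ^ a"
        by (simp add: binomial_ring)
      finally show ?thesis unfolding na zm by (simp add: l0 vec2_def)
    qed
    then have "(\<Sum>l\<in>S. \<Sum>m\<le>nat (- l 0 - 1). F (l, m)) = mpoly_eval 2 P (vec2 0 (x + y) x)"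
      unfolding poly_modes_sum[OF P] S_def[symmetric] by (intro sum.cong) auto
    then show "mpoly_eval 2 P (vec2 0 (x + y) x) = sum F (SIGMA l:S. {..nat (- l 0 - 1)})"
      using S sum.Sigma[of S "\<lambda>l. {..nat (- l 0 - 1)}" "\<lambda>l m. F (l, m)"] by simp
  qed (use S in auto)
  \<comment> \<open>Passes from target mode \<open>k\<close> and offset m to the source mode l;
    since l 0 + m = k 0, the coefficient in \<open>F\<close> becomes that of
    \<open>translate\<close>.\<close>
  moreover define g where "g = (\<lambda>(k, m). (antidiagonal 0 1 m k, m))"
  have g: "bij_betw g (idx 2 \<times> UNIV) (idx 2 \<times> UNIV)"
    by (rule bij_betwI[of _ _ _ "\<lambda>(k, m). (antidiagonal 1 0 m k, m)"])
       (auto simp: g_def antidiagonal_def fun_eq_iff intro!: idx_upd)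
  ultimately have "((\<lambda>x. F (g x)) has_sum mpoly_eval 2 P (vec2 0 (x + y) x)) (idx 2 \<times> UNIV)"
    using has_sum_reindex_bij_betw[OF g, of F] by blast
  then show ?thesis
  proof (rule has_sum_SigmaD)
    fix k assume k: "k \<in> idx 2"
    have Fg: "F (g (k, m)) = ?p (antidiagonal 0 1 m k) * translate_coef (k 0) m * mode_monomial 2 ?z k" for m
      using xy by (simp add: F_def g_def mode_monomial_antidiagonal vec2_def)
    have z: "?p (antidiagonal 0 1 m k) = 0" if "m \<ge> nat (- k 1)" for m
    proof -
      have "1 < (2::nat)" "\<not> antidiagonal 0 1 m k 1 < 0" using that by (auto simp: antidiagonal_def)
      then show ?thesis unfolding poly_modes_def by meson
    qed
    show "((\<lambda>m. F (g (k, m))) has_sum translate (*) 0 1 ?p k * mode_monomial 2 ?z k) UNIV"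
    proof (rule has_sum_finite_neutralI[of "{..<nat (- k 1)}"])
      show "translate (*) 0 1 ?p k * mode_monomial 2 ?z k = (\<Sum>m<nat (- k 1). F (g (k, m)))"
        unfolding Fg by (subst translate_eq[of "nat (- k 1)"]) (use z in \<open>auto simp: sum_distrib_left mult_ac\<close>)
      show "F (g (k, m)) = 0" if "m \<in> UNIV - {..<nat (- k 1)}" for m
        unfolding Fg using z[of m] that by simp
    qed simp_all
  qed
qed

section \<open>Eigenspaces of the grading operator\<close>

text \<open>The sum of the eigenspaces with eigenvalues in \<open>A\<close>. Eigenvalues are what
  the commutator formula for d computes, and they serve the integer grading of V and the complex
  grading of W alike.\<close>

definition eigspan :: "(complex \<Rightarrow> 'w::ab_group_add \<Rightarrow> 'w) \<Rightarrow> ('w \<Rightarrow> 'w) \<Rightarrow> complex set \<Rightarrow> 'w set" where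
  "eigspan s d A = module.span s {x. \<exists>c\<in>A. d x = s c x}"

lemma functional_hom:
  assumes "Vector_Spaces.linear s ((*) :: complex \<Rightarrow> _) f"
  shows "f (x + y) = f x + f y" "f (s c x) = c * f x" "f (sum g I) = (\<Sum>i\<in>I. f (g i))"
proof -
  interpret f: Vector_Spaces.linear s "(*)" f by fact
  show "f (x + y) = f x + f y" "f (s c x) = c * f x" "f (sum g I) = (\<Sum>i\<in>I. f (g i))"
    by (rule f.add f.scale f.sum)+
qed

locale graded_space = complex_vector_space s for s :: "complex \<Rightarrow> 'w::ab_group_add \<Rightarrow> 'w" +
  fixes G :: "'i \<Rightarrow> 'w set" and wt :: "'i \<Rightarrow> complex" and d :: "'w \<Rightarrow> 'w"
  assumes graded: "graded s G"
    and d_lin: "Vector_Spaces.linear s s d"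
    and d_wt: "\<And>m x. x \<in> G m \<Longrightarrow> d x = s (wt m) x"
    and lower: "\<exists>M. \<forall>m. Re (wt m) < M \<longrightarrow> G m = {0}"
begin

lemma subspace_G: "subspace (G i)"
  using graded by (auto simp: graded_def)

lemma decompose: "\<exists>S g. finite S \<and> (\<forall>i\<in>S. g i \<in> G i) \<and> x = (\<Sum>i\<in>S. g i)"
  using graded unfolding graded_def by (elim conjE) (erule spec)

lemma direct:
  assumes "finite S" "\<And>i. i \<in> S \<Longrightarrow> g i \<in> G i" "(\<Sum>i\<in>S. g i) = 0" "i \<in> S"
  shows "g i = 0"
proof -
  have "\<forall>S g. finite S \<and> (\<forall>i\<in>S. g i \<in> G i) \<and> (\<Sum>i\<in>S. g i) = 0 \<longrightarrow> (\<forall>i\<in>S. g i = 0)"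
    using graded unfolding graded_def by (elim conjE)
  from this[rule_format, of S g i] show ?thesis using assms by simp
qed

text \<open>Applying d - c to a homogeneous decomposition scales the piece at i by wt i - c;
  directness then kills every piece of another weight.\<close>

lemma eigenvector_decompose:
  assumes x: "d x = s c x"
  shows "\<exists>S g. finite S \<and> (\<forall>i\<in>S. g i \<in> G i \<and> wt i = c) \<and> x = (\<Sum>i\<in>S. g i)"
proof -
  interpret d: Vector_Spaces.linear s s d by (rule d_lin)
  obtain S g where S: "finite S" and g': "\<forall>i\<in>S. g i \<in> G i" and xS: "x = (\<Sum>i\<in>S. g i)"
    using decompose[of x] by blast
  have g: "g i \<in> G i" if "i \<in> S" for i using g' that by blast
  have "(\<Sum>i\<in>S. s (wt i - c) (g i)) = d x - s c x"
    unfolding xS d.sum scale_sum_right sum_subtractf[symmetric]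
    by (intro sum.cong refl) (simp add: d_wt[OF g] scale_left_diff_distrib)
  then have 0: "(\<Sum>i\<in>S. s (wt i - c) (g i)) = 0" using x by simp
  have "s (wt i - c) (g i) = 0" if "i \<in> S" for i
    using direct[OF S subspace_scale[OF subspace_G g] 0 that] .
  then have "g i = 0" if "i \<in> S" "wt i \<noteq> c" for i using that by (metis scale_eq_0_iff right_minus_eq)
  then have "x = (\<Sum>i | i \<in> S \<and> wt i = c. g i)"
    unfolding xS by (intro sum.mono_neutral_right S) auto
  then show ?thesis using S g by (intro exI[of _ "{i \<in> S. wt i = c}"] exI[of _ g]) auto
qed

lemma in_eigspan: obtains A where "finite A" "x \<in> eigspan s d A"
proof -
  obtain S g where S: "finite S" and g': "\<forall>i\<in>S. g i \<in> G i" and xS: "x = (\<Sum>i\<in>S. g i)"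
    using decompose[of x] by blast
  have g: "g i \<in> G i" if "i \<in> S" for i using g' that by blast
  have "x \<in> eigspan s d (wt ` S)"
    unfolding xS eigspan_def
  proof (intro span_sum span_base CollectI)
    fix i assume "i \<in> S"
    then show "\<exists>c\<in>wt ` S. d (g i) = s c (g i)" using d_wt[OF g] by blast
  qed
  then show ?thesis using that[of "wt ` S"] S by simp
qed

lemma eigspan_mono: "A \<subseteq> B \<Longrightarrow> eigspan s d A \<subseteq> eigspan s d B"
  unfolding eigspan_def by (rule span_mono) blast

lemma eigspan_bounded_below:
  obtains M where "\<And>A x. x \<in> eigspan s d A \<Longrightarrow> \<forall>c\<in>A. Re c < M \<Longrightarrow> x = 0"
proof -
  obtain M where M: "\<And>m. Re (wt m) < M \<Longrightarrow> G m = {0}" using lower by blast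
  have "x = 0" if x: "x \<in> eigspan s d A" and A: "\<forall>c\<in>A. Re c < M" for A x
  proof -
    have "{x. \<exists>c\<in>A. d x = s c x} \<subseteq> {0}"
    proof safe
      fix y c assume c: "c \<in> A" "d y = s c y"
      obtain S g where g: "\<forall>i\<in>S. g i \<in> G i \<and> wt i = c" "y = (\<Sum>i\<in>S. g i)"
        using eigenvector_decompose[OF c(2)] by blast
      have "g i = 0" if "i \<in> S" for i using M[of i] g(1) that A c(1) by auto
      then show "y = 0" using g(2) by simp
    qed
    then have "eigspan s d A \<subseteq> span {0}" unfolding eigspan_def by (rule span_mono)
    then show ?thesis using x by auto
  qed
  then show ?thesis using that by blast
qed

lemma gdual_eigspan:
  assumes "f \<in> gdual s G"
  obtains D where "finite D" "\<And>A x. x \<in> eigspan s d A \<Longrightarrow> A \<inter> D = {} \<Longrightarrow> f x = 0"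
proof -
  have lin: "Vector_Spaces.linear s (*) f"
    and "\<exists>S. finite S \<and> (\<forall>m. m \<notin> S \<longrightarrow> (\<forall>w\<in>G m. f w = 0))"
    using assms unfolding gdual_def by simp_all
  then obtain S where S: "finite S" "\<forall>m. m \<notin> S \<longrightarrow> (\<forall>w\<in>G m. f w = 0)" by blast
  note f = functional_hom[OF lin]
  have "f x = 0" if x: "x \<in> eigspan s d A" and A: "A \<inter> wt ` S = {}" for A x
    using x unfolding eigspan_def
  proof (induction rule: span_induct_alt)
    case (step c y z)
    then obtain a where a: "a \<in> A" "d y = s a y" by blast
    obtain I g where g: "\<forall>i\<in>I. g i \<in> G i \<and> wt i = a" "y = (\<Sum>i\<in>I. g i)"
      using eigenvector_decompose[OF a(2)] by blast
    have "f (g i) = 0" if "i \<in> I" for i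
    proof -
      have i: "g i \<in> G i" "wt i = a" using g(1) that by auto
      then have "i \<notin> S" using A a(1) by blast
      then show ?thesis using S(2) i(1) by blast
    qed
    then have "f y = 0" unfolding g(2) f(3) by (simp add: sum.neutral)
    then show ?case using step(2) by (simp add: f)
  next
    case base
    show ?case using f(2)[of 0 0] by simp
  qed
  then show ?thesis using that[of "wt ` S"] S(1) by simp
qed

text \<open>A functional is built that is 1 on one nonzero component of x and 0 on all other graded
  pieces, by extending from a basis of their span. This turns identities of matrix coefficients into
  identities of vectors, which can then be placed underneath further operators.\<close>

lemma gdual_separates:
  assumes "\<And>f. f \<in> gdual s G \<Longrightarrow> f x = 0"
  shows "x = 0"
proof (rule ccontr)
  assume "x \<noteq> 0"
  obtain S g where S: "finite S" and g': "\<forall>i\<in>S. g i \<in> G i" and xS: "x = (\<Sum>i\<in>S. g i)"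
    using decompose[of x] by blast
  have g: "g i \<in> G i" if "i \<in> S" for i using g' that by blast
  obtain i0 where i0: "i0 \<in> S" "g i0 \<noteq> 0" using \<open>x \<noteq> 0\<close> xS by (metis sum.neutral)
  define U where "U = (\<Union>j\<in>-{i0}. G j)"
  have U: "\<exists>I h. finite I \<and> i0 \<notin> I \<and> (\<forall>i\<in>I. h i \<in> G i) \<and> y = (\<Sum>i\<in>I. h i)" if "y \<in> span U" for y
    using that
  proof (induction rule: span_induct_alt)
    case base
    show ?case by (rule exI[of _ "{}"]) simp
  next
    case (step c y z)
    obtain j where j: "j \<noteq> i0" "y \<in> G j" using step(1) by (auto simp: U_def)
    obtain I h where I: "finite I" "i0 \<notin> I" "\<forall>i\<in>I. h i \<in> G i" "z = (\<Sum>i\<in>I. h i)" using step(2) by blast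
    let ?h = "\<lambda>i. (if i \<in> I then h i else 0) + (if i = j then s c y else 0)"
    have "(\<Sum>i\<in>insert j I. ?h i) = (\<Sum>i\<in>insert j I. if i \<in> I then h i else 0) + s c y"
      using I(1) by (subst sum.distrib) simp
    also have "(\<Sum>i\<in>insert j I. if i \<in> I then h i else 0) = z"
      unfolding I(4) using I(1) by (intro sum.mono_neutral_cong_right) auto
    finally have "s c y + z = (\<Sum>i\<in>insert j I. ?h i)" by (simp add: add.commute)
    moreover have "?h i \<in> G i" if "i \<in> insert j I" for i
      using I(3) j that by (intro subspace_add[OF subspace_G])
        (auto simp: subspace_0[OF subspace_G] subspace_scale[OF subspace_G])
    moreover have "finite (insert j I)" "i0 \<notin> insert j I" using I j by auto
    ultimately show ?case by (intro exI[of _ "insert j I"] exI[of _ ?h] conjI ballI)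
  qed
  have notin: "g i0 \<notin> span U"
  proof
    assume "g i0 \<in> span U"
    from U[OF this] obtain I h where I: "finite I" "i0 \<notin> I" "\<forall>i\<in>I. h i \<in> G i" "g i0 = (\<Sum>i\<in>I. h i)"
      by blast
    let ?h = "\<lambda>i. if i = i0 then - g i0 else h i"
    have "(\<Sum>i\<in>I. ?h i) = (\<Sum>i\<in>I. h i)" using I(2) by (intro sum.cong) auto
    then have "(\<Sum>i\<in>insert i0 I. ?h i) = 0"
      using I by simp
    moreover have "?h i \<in> G i" if "i \<in> insert i0 I" for i
      using I(3) that g[OF i0(1)] subspace_neg[OF subspace_G] by auto
    ultimately have "?h i0 = 0" using I(1) by (intro direct[of "insert i0 I" ?h i0]) auto
    then show False using i0 by simp
  qed
  obtain B where B: "B \<subseteq> U" "independent B" "U \<subseteq> span B"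
    using maximal_independent_subset by blast
  have "g i0 \<notin> span B" using notin span_mono[OF B(1)] by blast
  then have ind: "independent (insert (g i0) B)" "g i0 \<notin> B"
    using B(2) span_base by (auto simp: independent_insert)
  interpret vp: vector_space_pair s "(*) :: complex \<Rightarrow> complex \<Rightarrow> complex"
    by unfold_locales (auto simp: algebra_simps)
  obtain f where f: "Vector_Spaces.linear s (*) f" "\<forall>b\<in>insert (g i0) B. f b = (if b = g i0 then 1 else 0)"
    using vp.linear_independent_extend[OF ind(1), of "\<lambda>b. if b = g i0 then 1 else 0"] by blast
  have "f y = 0" if "y \<in> span B" for y
  proof (rule vp.linear_eq_0_on_span[OF f(1) _ that])
    fix b assume "b \<in> B"
    then show "f b = 0" using f(2) ind(2) by auto
  qed
  then have fU: "f y = 0" if "y \<in> G j" "j \<noteq> i0" for y j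
    using B(3) that by (auto simp: U_def)
  have "f \<in> gdual s G"
    unfolding gdual_def using f(1) fU by (auto intro!: exI[of _ "{i0}"])
  then have "f x = 0" by (rule assms)
  moreover have "f x = (\<Sum>i\<in>S. f (g i))" unfolding xS by (rule functional_hom(3)[OF f(1)])
  also have "\<dots> = (\<Sum>i\<in>S. if i = i0 then 1 else 0)"
    using f(2) fU g by (intro sum.cong) auto
  also have "\<dots> = 1" using S i0 by simp
  ultimately show False by simp
qed

end

locale graded_action =
  V: graded_space sV GV wtV dV + W: graded_space sW GW wtW dW
  for sV :: "complex \<Rightarrow> 'v::ab_group_add \<Rightarrow> 'v" and GV :: "'i \<Rightarrow> 'v set" and wtV dV
    and sW :: "complex \<Rightarrow> 'w::ab_group_add \<Rightarrow> 'w" and GW :: "'j \<Rightarrow> 'w set" and wtW dW +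
  fixes Y :: "int \<Rightarrow> 'v \<Rightarrow> 'w \<Rightarrow> 'w"
  assumes bilin: "bilinear_Y sV sW Y"
    and comm: "\<And>k u w. dW (Y k u w) - Y k u (dW w) = Y k (dV u) w + sW (of_int (- k - 1)) (Y k u w)"
begin

lemma lin_right: "Vector_Spaces.linear sW sW (Y k u)"
  and lin_left: "Vector_Spaces.linear sV sW (\<lambda>u. Y k u w)"
  using bilin by (auto simp: bilinear_Y_def)

text \<open>By the commutator formula the k-th mode sends weights a and b to a + b - k - 1;
  linearity in each argument extends this from eigenvectors to spans.\<close>

lemma eigspan_action:
  assumes u: "u \<in> eigspan sV dV A" and w: "w \<in> eigspan sW dW B"
  shows "Y k u w \<in> eigspan sW dW ((\<lambda>(a, b). a + b - of_int k - 1) ` (A \<times> B))"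
  using u unfolding eigspan_def
proof (induction rule: V.span_induct_alt)
  case base
  interpret l: Vector_Spaces.linear sV sW "\<lambda>u. Y k u w" by (rule lin_left)
  show ?case by (simp add: l.zero W.span_zero)
next
  case (step c x y)
  interpret l: Vector_Spaces.linear sV sW "\<lambda>u. Y k u w" by (rule lin_left)
  obtain a where a: "a \<in> A" "dV x = sV a x" using step(1) by blast
  have "Y k x w \<in> W.span {y. \<exists>c\<in>(\<lambda>(a, b). a + b - of_int k - 1) ` (A \<times> B). dW y = sW c y}"
    using w unfolding eigspan_def
  proof (induction rule: W.span_induct_alt)
    case base
    interpret r: Vector_Spaces.linear sW sW "Y k x" by (rule lin_right)
    show ?case by (simp add: r.zero W.span_zero)
  next
    case (step c x' y')
    interpret r: Vector_Spaces.linear sW sW "Y k x" by (rule lin_right)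
    interpret l: Vector_Spaces.linear sV sW "\<lambda>u. Y k u x'" by (rule lin_left)
    obtain b where b: "b \<in> B" "dW x' = sW b x'" using step(1) by blast
    have "dW (Y k x x') = Y k x (dW x') + Y k (dV x) x' + sW (of_int (- k - 1)) (Y k x x')"
      using comm[of k x x'] by (simp add: algebra_simps)
    also have "\<dots> = sW (a + b - of_int k - 1) (Y k x x')"
      unfolding b a(2) r.scale l.scale W.scale_left_distrib[symmetric] by (simp add: algebra_simps)
    finally have "dW (Y k x x') = sW (a + b - of_int k - 1) (Y k x x')" .
    then have "Y k x x' \<in> W.span {y. \<exists>c\<in>(\<lambda>(a, b). a + b - of_int k - 1) ` (A \<times> B). dW y = sW c y}"
      using a(1) b(1) by (intro W.span_base CollectI bexI[of _ "a + b - of_int k - 1"] image_eqI[of _ _ "(a, b)"]) auto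
    then show ?case using step(2) by (simp add: r.add r.scale W.span_add W.span_scale)
  qed
  then show ?case using step(2) by (simp add: l.add l.scale W.span_add W.span_scale)
qed

text \<open>The finitely many weights a + b - k - 1 fall below the lower bound of the grading as k
  grows.\<close>

lemma truncation: "\<exists>K. \<forall>k\<ge>K. Y k u w = 0"
proof -
  obtain A where A: "finite A" "u \<in> eigspan sV dV A" by (rule V.in_eigspan)
  obtain B where B: "finite B" "w \<in> eigspan sW dW B" by (rule W.in_eigspan)
  obtain M where M: "\<And>A x. x \<in> eigspan sW dW A \<Longrightarrow> \<forall>c\<in>A. Re c < M \<Longrightarrow> x = 0"
    by (rule W.eigspan_bounded_below) blast
  define R where "R = (\<lambda>(a, b). Re a + Re b) ` (A \<times> B)"
  have "finite R" using A B by (simp add: R_def)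
  then obtain r where r: "\<And>x. x \<in> R \<Longrightarrow> x \<le> r" by (meson bdd_above.unfold bdd_above_finite)
  have "Y k u w = 0" if "k \<ge> \<lceil>r - M\<rceil>" for k
  proof (rule M[OF eigspan_action[OF A(2) B(2)]], safe)
    fix a b assume "a \<in> A" "b \<in> B"
    then have "Re a + Re b \<le> r" by (intro r) (force simp: R_def)
    then show "Re (a + b - of_int k - 1) < M" using that by simp linarith
  qed
  then show ?thesis by blast
qed

text \<open>Each operator adds finitely many weights of its vector and the shift - k - 1, so the
  modes enter only through their sum.\<close>

lemma opprod_eigspan:
  obtains C where "finite C"
    "\<And>k. opprod Y u k i m w \<in> eigspan sW dW ((\<lambda>c. c - of_int (\<Sum>j\<in>{i..<i+m}. k j)) ` C)"
proof (induction m arbitrary: i thesis)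
  case 0
  obtain B where "finite B" "w \<in> eigspan sW dW B" by (rule W.in_eigspan)
  then show ?case using 0[of B] by simp
next
  case (Suc m)
  obtain A where A: "finite A" "u i \<in> eigspan sV dV A" by (rule V.in_eigspan)
  obtain C where C: "finite C" "\<And>k. opprod Y u k (Suc i) m w \<in>
      eigspan sW dW ((\<lambda>c. c - of_int (\<Sum>j\<in>{Suc i..<Suc i+m}. k j)) ` C)"
    using Suc.IH[of "Suc i"] by blast
  define C' where "C' = (\<lambda>(a, c). a + c - 1) ` (A \<times> C)"
  have "opprod Y u k i (Suc m) w \<in> eigspan sW dW ((\<lambda>c. c - of_int (\<Sum>j\<in>{i..<i+Suc m}. k j)) ` C')" for k
  proof -
    have "(\<Sum>j\<in>{i..<i+Suc m}. k j) = k i + (\<Sum>j\<in>{Suc i..<Suc i+m}. k j)"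
      by (subst sum.atLeast_Suc_lessThan) auto
    then have t: "a + (c - of_int (\<Sum>j\<in>{Suc i..<Suc i+m}. k j)) - of_int (k i) - 1 =
        (a + c - 1) - of_int (\<Sum>j\<in>{i..<i+Suc m}. k j)" for a c :: complex
      by simp
    have "(\<lambda>(a, b). a + b - of_int (k i) - 1) ` (A \<times> (\<lambda>c. c - of_int (\<Sum>j\<in>{Suc i..<Suc i+m}. k j)) ` C) \<subseteq>
      (\<lambda>c. c - of_int (\<Sum>j\<in>{i..<i+Suc m}. k j)) ` C'"
    proof (clarify, unfold t)
      fix a c assume "a \<in> A" "c \<in> C"
      then have "a + c - 1 \<in> C'" unfolding C'_def by (intro image_eqI[of _ _ "(a, c)"]) auto
      then show "a + c - 1 - of_int (\<Sum>j\<in>{i..<i+Suc m}. k j) \<in>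
          (\<lambda>c. c - of_int (\<Sum>j\<in>{i..<i+Suc m}. k j)) ` C'" by (rule imageI)
    qed
    from W.eigspan_mono[OF this] show ?thesis using eigspan_action[OF A(2) C(2)[of k], of "k i"] by auto
  qed
  then show ?case using Suc.prems[of C'] A C by (simp add: C'_def)
qed

text \<open>A functional of the graded dual sees finitely many weights, which confines the sum of
  the modes to a finite set of differences.\<close>

lemma opprod_degree:
  assumes "f \<in> gdual sW GW"
  obtains D where "finite D" "\<And>k. f (opprod Y u k 0 n w) \<noteq> 0 \<Longrightarrow> (\<Sum>j<n. k j) \<in> D"
proof -
  obtain E where E: "finite E" "\<And>A x. x \<in> eigspan sW dW A \<Longrightarrow> A \<inter> E = {} \<Longrightarrow> f x = 0"
    by (rule W.gdual_eigspan[OF assms]) blast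
  obtain C where C: "finite C"
    "\<And>k. opprod Y u k 0 n w \<in> eigspan sW dW ((\<lambda>c. c - of_int (\<Sum>j\<in>{0..<0+n}. k j)) ` C)"
    by (rule opprod_eigspan) blast
  define D where "D = (of_int :: int \<Rightarrow> complex) -` ((\<lambda>(c, e). c - e) ` (C \<times> E))"
  show ?thesis
  proof (rule that[of D])
    show "finite D" unfolding D_def using C E by (intro finite_vimageI) (auto simp: inj_on_def)
    fix k assume "f (opprod Y u k 0 n w) \<noteq> 0"
    then have "(\<lambda>c. c - of_int (\<Sum>j\<in>{0..<0+n}. k j)) ` C \<inter> E \<noteq> {}" using E(2) C(2) by blast
    then obtain c where "c \<in> C" "c - of_int (\<Sum>j<n. k j) \<in> E" by (auto simp: atLeast0LessThan)
    then show "(\<Sum>j<n. k j) \<in> D" unfolding D_def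
      by (intro vimageI2 image_eqI[of _ _ "(c, c - of_int (\<Sum>j<n. k j))"]) auto
  qed
qed

end

section \<open>Weak associativity\<close>

text \<open>The shape of Y(u, x_p) Y(v, x_q) w: modes of the inner operator are bounded outright,
  those of the outer one only once the inner mode is fixed. For iterates the roles are p = 1 and q =
  0.\<close>

definition truncated2 :: "nat \<Rightarrow> nat \<Rightarrow> ((nat \<Rightarrow> int) \<Rightarrow> complex) \<Rightarrow> bool" where
  "truncated2 p q T \<longleftrightarrow> (\<exists>c. \<forall>k. k q \<ge> c \<longrightarrow> T k = 0) \<and> (\<forall>b. \<exists>c'. \<forall>k. k q = b \<longrightarrow> k p \<ge> c' \<longrightarrow> T k = 0)"

lemma truncated2_linform_mult:
  assumes T: "truncated2 p q T" and pq: "p \<noteq> q"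
  shows "truncated2 p q (linform_mult (*) n l T)"
  unfolding truncated2_def
proof (intro conjI allI)
  obtain c where c: "\<And>k. k q \<ge> c \<Longrightarrow> T k = 0" using T by (auto simp: truncated2_def)
  have "linform_mult (*) n l T k = 0" if "k q \<ge> c" for k
  proof -
    have "T (k(i := k i + 1)) = 0" for i by (rule c) (use that in auto)
    then show ?thesis by (simp add: linform_mult_def)
  qed
  then show "\<exists>c. \<forall>k. k q \<ge> c \<longrightarrow> linform_mult (*) n l T k = 0" by blast
next
  fix b
  have "\<forall>b. \<exists>c'. \<forall>k. k q = b \<longrightarrow> k p \<ge> c' \<longrightarrow> T k = 0"
    using T unfolding truncated2_def by blast
  then obtain c where c: "\<And>b k. k q = b \<Longrightarrow> k p \<ge> c b \<Longrightarrow> T k = 0" by metis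
  have "linform_mult (*) n l T k = 0" if k: "k q = b" "k p \<ge> max (c b) (c (b + 1))" for k
  proof -
    have "T (k(i := k i + 1)) = 0" for i
      using k pq by (intro c[of _ "if i = q then b + 1 else b"]) auto
    then show ?thesis by (simp add: linform_mult_def)
  qed
  then show "\<exists>c'. \<forall>k. k q = b \<longrightarrow> k p \<ge> c' \<longrightarrow> linform_mult (*) n l T k = 0" by blast
qed

lemma truncated2_linform_mults: "truncated2 p q T \<Longrightarrow> p \<noteq> q \<Longrightarrow> truncated2 p q (linform_mults (*) n ls T)"
  by (induction ls) (auto intro: truncated2_linform_mult)

lemma truncated2_regular: "regular p T \<Longrightarrow> regular q T \<Longrightarrow> truncated2 p q T"
  by (auto simp: truncated2_def regular_def intro!: exI[of _ 0])

text \<open>Comparing sums at real points 0 < y < x suffices; this region lies in the domains of convergence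
  of both products (in x_0 = x, x_1 = y) and iterates (in x_0 - x_1 = y, x_1 = x).\<close>

lemma laurent_series_eq_idx2:
  assumes pq: "p < 2" "q < 2" "p \<noteq> q" and T: "truncated2 p q T" and T': "truncated2 p q T'"
    and S: "\<And>x y. 0 < y \<Longrightarrow> y < x \<Longrightarrow> \<exists>R.
      ((\<lambda>k. T k * mode_monomial 2 (vec2 p (of_real x) (of_real y)) k) has_sum R) (idx 2) \<and>
      ((\<lambda>k. T' k * mode_monomial 2 (vec2 p (of_real x) (of_real y)) k) has_sum R) (idx 2)"
    and k: "k \<in> idx 2"
  shows "T k = T' k"
proof -
  obtain c c' where c: "\<And>k. k q \<ge> c \<Longrightarrow> T k = 0" "\<And>k. k q \<ge> c' \<Longrightarrow> T' k = 0"
    using T T' by (auto simp: truncated2_def)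
  have "T k - T' k = 0"
  proof (rule laurent_series_unique_idx2[OF pq _ _ _ k, of "max c c'" "\<lambda>k. T k - T' k"])
    show "\<exists>c'. \<forall>k. k q = b \<longrightarrow> c' \<le> k p \<longrightarrow> T k - T' k = 0" for b
    proof -
      obtain d d' where "\<And>k. k q = b \<Longrightarrow> k p \<ge> d \<Longrightarrow> T k = 0" "\<And>k. k q = b \<Longrightarrow> k p \<ge> d' \<Longrightarrow> T' k = 0"
        using T T' unfolding truncated2_def by metis
      then show ?thesis by (intro exI[of _ "max d d'"]) auto
    qed
    show "((\<lambda>k. (T k - T' k) * mode_monomial 2 (vec2 p (of_real x) (of_real y)) k) has_sum 0) (idx 2)"
      if xy: "0 < y" "y < x" for x y
    proof -
      obtain R where R: "((\<lambda>k. T k * mode_monomial 2 (vec2 p (of_real x) (of_real y)) k) has_sum R) (idx 2)"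
        "((\<lambda>k. T' k * mode_monomial 2 (vec2 p (of_real x) (of_real y)) k) has_sum R) (idx 2)"
        using S[OF xy] by blast
      show ?thesis using has_sum_add[OF R(1) has_sum_cmult_right[OF R(2), of "-1"]] by (simp add: left_diff_distrib)
    qed
  qed (use c in auto)
  then show ?thesis by simp
qed

lemma regular_poly_modes: "i < n \<Longrightarrow> regular i (poly_modes n P)"
  unfolding regular_def poly_modes_def by (meson not_less)

lemma translate_cong: "(\<And>m. T (antidiagonal j p m k) = T' (antidiagonal j p m k)) \<Longrightarrow> translate s j p T k = translate s j p T' k"
  by (simp add: translate_def)

text \<open>The case W = V is included; the induction over the number of operators takes place
  there.\<close>

locale vertex_module =
  V: graded_action sV GV wtV dV sV GV wtV dV YV +
  W: graded_action sV GV wtV dV sW GW wtW dW YW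
  for sV :: "complex \<Rightarrow> 'v::ab_group_add \<Rightarrow> 'v" and GV :: "'i \<Rightarrow> 'v set" and wtV dV YV
    and sW :: "complex \<Rightarrow> 'w::ab_group_add \<Rightarrow> 'w" and GW :: "'j \<Rightarrow> 'w set" and wtW dW YW +
  assumes iter: "rational_iter sW GW YW YV"
    and assoc: "assoc_ax sW GW YW YV"
    and pole: "pole_order sW GW YW"
begin

lemma YW_zero [simp]: "YW k 0 w = 0" "YW k u 0 = 0"
proof -
  interpret l: Vector_Spaces.linear sV sW "\<lambda>u. YW k u w" by (rule W.lin_left)
  interpret r: Vector_Spaces.linear sW sW "YW k u" by (rule W.lin_right)
  show "YW k 0 w = 0" "YW k u 0 = 0" by (rule l.zero r.zero)+
qed

text \<open>Both sides are compared with one polynomial, the numerator of the rational function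
  times a power of z_0. The factors x_0^N, (x_0 - x_1)^c and x_1^(a 1) clear the denominator. The
  substitution turns (x_0 - x_1)^c into x_0^c, so all of them except x_0^N become monomials, that
  is, index shifts. These can be undone, and the exponents \<open>c\<close> and \<open>a 1\<close>,
  which may vary with \<open>f\<close>, disappear.\<close>

lemma weak_associativity_functional:
  assumes f: "f \<in> gdual sW GW"
    and conv: "conv_rat 2 (prod_term YW f (pair u v) 2 w) (Dprod 2) a b" and N: "a 0 \<le> N"
    and k: "k \<in> idx 2"
  shows "translate (*) 0 1 (linform_mults (*) 2 (replicate N (xvar 0)) (\<lambda>k. f (YW (k 0) u (YW (k 1) v w)))) k =
         linform_mults (*) 2 (replicate N (\<lambda>m. xvar 0 m + xvar 1 m)) (\<lambda>k. f (YW (k 1) (YV (k 0) u v) w)) k"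
proof -
  interpret c: complex_vector_space "(*) :: complex \<Rightarrow> complex \<Rightarrow> complex" by (rule complex_vector_space_complex)
  define A where "A = (\<lambda>k::nat\<Rightarrow>int. f (YW (k 0) u (YW (k 1) v w)))"
  define B where "B = (\<lambda>k::nat\<Rightarrow>int. f (YW (k 1) (YV (k 0) u v) w))"
  have lin: "Vector_Spaces.linear sW (*) f" using f by (simp add: gdual_def)
  have f0: "f 0 = 0" using functional_hom(2)[OF lin, of 0 0] by simp
  obtain P where P: "mpoly 2 P"
    and sA: "\<And>z. z \<in> Dprod 2 \<Longrightarrow> ((\<lambda>k. prod_term YW f (pair u v) 2 w k z) has_sum rat_fun 2 P a b z) (idx 2)"
    using conv by (auto simp: conv_rat_def)
  define c where "c = b 0 1"
  define p where "p = poly_modes 2 P"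
  define R where "R = (\<lambda>z. rat_fun 2 P a b z)"
  have R: "R z = mpoly_eval 2 P z / (z 0 ^ a 0 * z 1 ^ a 1 * (z 0 - z 1) ^ c)" for z
  proof -
    have "{0<..<2::nat} = {1}" "{1<..<2::nat} = {}" by auto
    then have "(\<Prod>i<2. \<Prod>j\<in>{i<..<2}. (z i - z j) ^ b i j) = (z 0 - z 1) ^ c"
      by (simp add: numeral_2_eq_2 c_def)
    then show ?thesis unfolding R_def rat_fun_def by (simp add: numeral_2_eq_2)
  qed
  have sA: "((\<lambda>k. A k * mode_monomial 2 z k) has_sum R z) (idx 2)" if "z \<in> Dprod 2" for z
    using sA[OF that] by (simp add: prod_term_def A_def pair_def mode_monomial_def numeral_2_eq_2 R_def)
  have rv: "regular 0 p" "regular 1 p" unfolding p_def by (simp_all add: regular_poly_modes)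
  have two: "i < 2 \<longleftrightarrow> i = 0 \<or> i = 1" for i :: nat by auto
  have s2: "(\<Sum>i<2. g i) = g 0 + g 1" for g :: "nat \<Rightarrow> complex" by (simp add: numeral_2_eq_2)
  have pr: "(\<Prod>l\<leftarrow>replicate r l0. h l) = h l0 ^ r" for r h and l0 :: "nat \<Rightarrow> complex"
    by (induction r) auto
  define A2 where "A2 = linform_mults (*) 2 (replicate N (xvar 0)) A"
  define L where "L = (\<lambda>T. linform_mults (*) 2 (replicate c (xvar 0) @ replicate (a 1) (xvar 1)) (T :: (nat \<Rightarrow> int) \<Rightarrow> complex))"
  define A1 where "A1 = linform_mults (*) 2 (replicate c (xdiff 0 1) @ replicate (a 1) (xvar 1)) A2"
  define p1 where "p1 = linform_mults (*) 2 (replicate (N - a 0) (xvar 0)) p"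
  obtain Kw where Kw: "\<And>k. k \<ge> Kw \<Longrightarrow> YW k v w = 0" using W.truncation by blast
  have tA: "truncated2 0 1 A"
    unfolding truncated2_def
  proof (intro conjI allI)
    show "\<exists>c. \<forall>k. c \<le> k 1 \<longrightarrow> A k = 0"
      using Kw by (intro exI[of _ Kw]) (auto simp: A_def f0)
    fix b
    obtain K where "\<And>k. k \<ge> K \<Longrightarrow> YW k u (YW b v w) = 0" using W.truncation by blast
    then show "\<exists>c'. \<forall>k. k 1 = b \<longrightarrow> c' \<le> k 0 \<longrightarrow> A k = 0"
      by (intro exI[of _ K]) (auto simp: A_def f0)
  qed
  obtain Kv where Kv: "\<And>k. k \<ge> Kv \<Longrightarrow> YV k u v = 0" using V.truncation by blast
  have tB: "truncated2 1 0 B"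
    unfolding truncated2_def
  proof (intro conjI allI)
    show "\<exists>c. \<forall>k. c \<le> k 0 \<longrightarrow> B k = 0"
      using Kv by (intro exI[of _ Kv]) (auto simp: B_def f0)
    fix b
    obtain K where "\<And>k. k \<ge> K \<Longrightarrow> YW k (YV b u v) w = 0" using W.truncation by blast
    then show "\<exists>c'. \<forall>k. k 0 = b \<longrightarrow> c' \<le> k 1 \<longrightarrow> B k = 0"
      by (intro exI[of _ K]) (auto simp: B_def f0)
  qed
  have trA: "truncated 0 1 A" unfolding truncated_def
  proof
    fix k
    have "A (antidiagonal 0 1 m k) = 0" if "m \<ge> nat (Kw - k 1)" for m
      using that Kw[of "k 1 + int m"] by (simp add: A_def antidiagonal_def f0)
    then show "\<exists>B. \<forall>m\<ge>B. A (antidiagonal 0 1 m k) = 0" by blast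
  qed
  then have trA2: "truncated 0 1 A2" unfolding A2_def by (intro c.truncated_linform_mults) auto
  \<comment> \<open>On 0 < y < x the cleared product sums to x^(N - a 0) times the numerator;
    uniqueness makes the equality formal.\<close>
  have eq1: "A1 k = p1 k" if "k \<in> idx 2" for k
  proof (rule laurent_series_eq_idx2[of 0 1])
    show "truncated2 0 1 A1" unfolding A1_def A2_def by (intro truncated2_linform_mults tA) auto
    show "truncated2 0 1 p1" unfolding p1_def by (intro truncated2_linform_mults truncated2_regular rv) auto
    fix x y :: real assume xy: "0 < y" "y < x"
    let ?z = "vec2 0 (complex_of_real x) (of_real y)"
    have z: "?z 0 = of_real x" "?z 1 = of_real y" by (auto simp: vec2_def)
    have zD: "?z \<in> Dprod 2" and z0: "i < 2 \<Longrightarrow> ?z i \<noteq> 0" for i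
      using xy by (auto simp: Dprod_def vec2_def)
    have nz: "complex_of_real x \<noteq> 0" "complex_of_real y \<noteq> 0" "complex_of_real x - of_real y \<noteq> 0"
      using xy by (auto simp flip: of_real_diff)
    have "((\<lambda>k. A1 k * mode_monomial 2 ?z k) has_sum (of_real x - of_real y) ^ c * of_real y ^ a 1 * (of_real x ^ N * R ?z)) (idx 2)"
      using has_sum_linform_mults[OF z0 has_sum_linform_mults[OF z0 sA[OF zD], of "replicate N (xvar 0)"],
         of "replicate c (xdiff 0 1) @ replicate (a 1) (xvar 1)"]
      by (simp add: A1_def A2_def pr s2 xdiff_def xvar_def z del: map_replicate One_nat_def)
    also have "(of_real x - of_real y) ^ c * of_real y ^ a 1 * (of_real x ^ N * R ?z) =
        of_real x ^ (N - a 0) * mpoly_eval 2 P ?z"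
      unfolding R z using nz N by (simp add: power_diff)
    finally have 1: "((\<lambda>k. A1 k * mode_monomial 2 ?z k) has_sum of_real x ^ (N - a 0) * mpoly_eval 2 P ?z) (idx 2)" .
    have 2: "((\<lambda>k. p1 k * mode_monomial 2 ?z k) has_sum of_real x ^ (N - a 0) * mpoly_eval 2 P ?z) (idx 2)"
      using has_sum_linform_mults[OF z0 has_sum_poly_modes[OF P, of ?z], of "replicate (N - a 0) (xvar 0)"]
      by (simp add: p1_def p_def pr s2 xdiff_def xvar_def z del: map_replicate One_nat_def)
    show "\<exists>R. ((\<lambda>k. A1 k * mode_monomial 2 ?z k) has_sum R) (idx 2) \<and> ((\<lambda>k. p1 k * mode_monomial 2 ?z k) has_sum R) (idx 2)"
      using 1 2 by blast
  qed (use that in auto)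
  have trp: "truncated 0 1 p" unfolding truncated_def
  proof
    fix k
    have "p (antidiagonal 0 1 m k) = 0" if "m \<ge> nat (- k 1)" for m
      using that by (intro regularD[OF rv(2)]) (simp add: antidiagonal_def)
    then show "\<exists>B. \<forall>m\<ge>B. p (antidiagonal 0 1 m k) = 0" by blast
  qed
  have phi1: "translate (*) 0 1 A1 = L (translate (*) 0 1 A2)"
  proof -
    have e: "(xdiff 0 1)(1 := xdiff 0 1 1 + xdiff 0 1 0) = xvar 0" "(xvar 1)(1 := xvar 1 1 + xvar 1 0) = xvar 1"
      by (auto simp: xdiff_def xvar_def fun_eq_iff)
    show ?thesis
      unfolding A1_def L_def by (subst c.translate_linform_mults) (use trA2 e in auto)
  qed
  define q1 where "q1 = linform_mults (*) 2 (replicate (N - a 0) (\<lambda>m. xvar 0 m + xvar 1 m)) (translate (*) 0 1 p)"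
  have phi2: "translate (*) 0 1 p1 = q1"
  proof -
    have e: "(xvar 0)(1 := xvar 0 1 + xvar 0 0) = (\<lambda>m. xvar 0 m + xvar 1 m)"
      by (auto simp: xdiff_def xvar_def fun_eq_iff)
    show ?thesis
      unfolding p1_def q1_def by (subst c.translate_linform_mults) (use trp e in auto)
  qed
  define B1 where "B1 = L (linform_mults (*) 2 (replicate N (\<lambda>m. xvar 0 m + xvar 1 m)) B)"
  \<comment> \<open>Variables 0 and 1 now stand for z_0 - z_1 and z_1, with values y and x. The
    point (z_0, z_1) = (x + y, x) lies in all three domains when 0 < y < x, so associativity carries
    the sum of the product over to the iterate.\<close>
  have eq2: "B1 k = q1 k" if "k \<in> idx 2" for k
  proof (rule laurent_series_eq_idx2[of 1 0])
    show "truncated2 1 0 B1" unfolding B1_def L_def by (intro truncated2_linform_mults tB) auto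
    show "truncated2 1 0 q1" unfolding q1_def
      by (intro truncated2_linform_mults truncated2_regular c.regular_translate rv) auto
    fix x y :: real assume xy: "0 < y" "y < x"
    let ?z = "vec2 1 (complex_of_real x) (of_real y)"
    have zz: "?z = vec2 0 (of_real y) (of_real x)" by (auto simp: vec2_def fun_eq_iff)
    let ?y = "vec2 0 (complex_of_real x + of_real y) (of_real x)"
    have z: "?z 0 = of_real y" "?z 1 = of_real x" "?y 0 = of_real x + of_real y" "?y 1 = of_real x"
      by (auto simp: vec2_def)
    have z0: "?z i \<noteq> 0" if "i < 2" for i
      using xy that by (auto simp: vec2_def)
    have nz: "complex_of_real x \<noteq> 0" "complex_of_real y \<noteq> 0" "complex_of_real x + of_real y \<noteq> 0"
      using xy by (auto simp flip: of_real_add)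
    have nr: "norm (complex_of_real x + of_real y) = x + y" "norm (complex_of_real x) = x" "norm (complex_of_real y) = y"
      using xy by (auto simp flip: of_real_add)
    have yD: "?y \<in> Dprod 2" "?y \<in> Dassoc" "?y \<in> Diter"
      unfolding Dprod_def Dassoc_def Diter_def mem_Collect_eq z
      using xy nr nz by (auto simp: two z z[unfolded One_nat_def] less_Suc_eq)
    obtain a' b' where "conv_rat 2 (iter_term YW YV f u v w) Diter a' b'"
      using iter f unfolding rational_iter_def by blast
    then obtain R' where R': "((\<lambda>k. iter_term YW YV f u v w k ?y) has_sum R') (idx 2)"
      using yD unfolding conv_rat_def by blast
    have "infsum (\<lambda>k. prod_term YW f (pair u v) 2 w k ?y) (idx 2) = R ?y"
      using sA[OF yD(1)] by (intro infsumI) (simp add: prod_term_def A_def pair_def mode_monomial_def numeral_2_eq_2)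
    moreover have "infsum (\<lambda>k. prod_term YW f (pair u v) 2 w k ?y) (idx 2) =
        infsum (\<lambda>k. iter_term YW YV f u v w k ?y) (idx 2)"
      using assoc f yD(2) unfolding assoc_ax_def by blast
    ultimately have "R' = R ?y" using infsumI[OF R'] by simp
    moreover have "iter_term YW YV f u v w k ?y = B k * mode_monomial 2 ?z k" for k
      unfolding iter_term_def mode_monomial_def z B_def by (simp add: numeral_2_eq_2 vec2_def)
    ultimately have sB: "((\<lambda>k. B k * mode_monomial 2 ?z k) has_sum R ?y) (idx 2)"
      using R' by simp
    have "((\<lambda>k. B1 k * mode_monomial 2 ?z k) has_sum (of_real y) ^ c * of_real x ^ a 1 * ((of_real x + of_real y) ^ N * R ?y)) (idx 2)"
      using has_sum_linform_mults[OF z0 has_sum_linform_mults[OF z0 sB, of "replicate N (\<lambda>m. xvar 0 m + xvar 1 m)"],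
         of "replicate c (xvar 0) @ replicate (a 1) (xvar 1)"]
      by (simp add: B1_def L_def pr s2 xvar_def z add.commute del: map_replicate One_nat_def)
    also have "(of_real y) ^ c * of_real x ^ a 1 * ((of_real x + of_real y) ^ N * R ?y) =
        (of_real x + of_real y) ^ (N - a 0) * mpoly_eval 2 P ?y"
      unfolding R z using nz N by (simp add: power_diff)
    finally have 1: "((\<lambda>k. B1 k * mode_monomial 2 ?z k) has_sum
        (of_real x + of_real y) ^ (N - a 0) * mpoly_eval 2 P ?y) (idx 2)" .
    have "((\<lambda>k. translate (*) 0 1 p k * mode_monomial 2 ?z k) has_sum mpoly_eval 2 P ?y) (idx 2)"
      unfolding zz p_def by (rule has_sum_translate_poly_modes[OF P]) (use nz in auto)
    from has_sum_linform_mults[OF z0 this, of "replicate (N - a 0) (\<lambda>m. xvar 0 m + xvar 1 m)"]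
    have 2: "((\<lambda>k. q1 k * mode_monomial 2 ?z k) has_sum
        (of_real x + of_real y) ^ (N - a 0) * mpoly_eval 2 P ?y) (idx 2)"
      by (simp add: q1_def pr s2 xvar_def z add.commute del: map_replicate One_nat_def)
    show "\<exists>R. ((\<lambda>k. B1 k * mode_monomial 2 ?z k) has_sum R) (idx 2) \<and> ((\<lambda>k. q1 k * mode_monomial 2 ?z k) has_sum R) (idx 2)"
      using 1 2 by blast
  qed (use that in auto)
  have L: "L T k = T (k(0 := k 0 + int c, 1 := k 1 + int (a 1)))" for T k
    unfolding L_def linform_mults_append by (simp add: c.linform_mults_replicate_xvar)
  \<comment> \<open>Reading the equality at the mode lowered by \<open>c\<close> and
    \<open>a 1\<close> undoes the monomial factor \<open>L\<close>.\<close>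
  let ?k = "k(0 := k 0 - int c, 1 := k 1 - int (a 1))"
  have k': "?k \<in> idx 2" using k by (auto simp: idx_def)
  have kk: "?k(0 := ?k 0 + int c, 1 := ?k 1 + int (a 1)) = k" by (auto simp: fun_eq_iff)
  have "translate (*) 0 1 A2 k = L (translate (*) 0 1 A2) ?k" unfolding L kk ..
  also have "\<dots> = translate (*) 0 1 p1 ?k"
    unfolding phi1[symmetric] by (intro translate_cong eq1 antidiagonal_idx k') auto
  also have "\<dots> = B1 ?k" unfolding phi2 using eq2[OF k'] by simp
  also have "\<dots> = linform_mults (*) 2 (replicate N (\<lambda>m. xvar 0 m + xvar 1 m)) B k"
    unfolding B1_def L kk ..
  finally show ?thesis unfolding A2_def A_def B_def .
qed

text \<open>The coefficient at modes a of x0 and b of x1 in the formal identity with factor (x0 +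
  x1)^N. \<open>B\<close> is any offset past which the modes of v annihilate w, so that the left
  side is a finite sum.\<close>

definition weakly_associative :: "nat \<Rightarrow> 'v \<Rightarrow> 'v \<Rightarrow> 'w \<Rightarrow> bool" where
  "weakly_associative N u v w \<longleftrightarrow> (\<forall>a b B. (\<forall>m\<ge>B. YW (b + int m) v w = 0) \<longrightarrow>
     (\<Sum>m<B. sW (translate_coef a m) (YW (a + int N - int m) u (YW (b + int m) v w))) =
     (\<Sum>m\<le>N. sW (of_nat (N choose m)) (YW (b + int m) (YV (a + int N - int m) u v) w)))"

lemma weak_associativity:
  "\<exists>N. \<forall>u w. (\<forall>k\<ge>int (N u w). YW k u w = 0) \<and> (\<forall>v. weakly_associative (N u w) u v w)"
proof -
  obtain N0 where N0: "\<forall>u1 u2 w. \<forall>f\<in>gdual sW GW. \<exists>a b. a 0 \<le> N0 u1 w \<and>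
        conv_rat 2 (prod_term YW f (pair u1 u2) 2 w) (Dprod 2) a b"
    using pole unfolding pole_order_def by (elim exE)
  define K where "K = (\<lambda>u w. SOME K. \<forall>k\<ge>K. YW k u w = 0)"
  have "\<forall>k\<ge>K u w. YW k u w = 0" for u w
    unfolding K_def by (rule someI_ex[OF W.truncation])
  then have K: "YW k u w = 0" if "k \<ge> K u w" for u w k
    using that by blast
  \<comment> \<open>\<open>N0\<close> bounds the pole. The maximum with \<open>K\<close> also makes
    the modes of u on w vanish from \<open>N\<close> on, which settles the innermost variable in
    \<open>regular_products_Suc\<close>.\<close>
  define N where "N = (\<lambda>u w. max (N0 u w) (nat (K u w)))"
  have "weakly_associative (N u w) u v w" for u v w
    unfolding weakly_associative_def
  proof (intro allI impI)
    fix a b B assume B: "\<forall>m\<ge>B. YW (b + int m) v w = 0"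
    let ?l = "\<Sum>m<B. sW (translate_coef a m) (YW (a + int (N u w) - int m) u (YW (b + int m) v w))"
    let ?r = "\<Sum>m\<le>N u w. sW (of_nat (N u w choose m)) (YW (b + int m) (YV (a + int (N u w) - int m) u v) w)"
    \<comment> \<open>Because \<open>N\<close> was chosen before the functional, the identity holds
      for all functionals at once and hence for vectors.\<close>
    have "?l - ?r = 0"
    proof (rule W.W.gdual_separates)
      fix f assume f: "f \<in> gdual sW GW"
      interpret c: complex_vector_space "(*) :: complex \<Rightarrow> complex \<Rightarrow> complex" by (rule complex_vector_space_complex)
      have lin: "Vector_Spaces.linear sW (*) f" using f by (simp add: gdual_def)
      note hom = functional_hom[OF lin]
      have f0: "f 0 = 0" using hom(2)[of 0 0] by simp
      obtain a' b' where ab: "a' 0 \<le> N0 u w" "conv_rat 2 (prod_term YW f (pair u v) 2 w) (Dprod 2) a' b'"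
        using N0[rule_format, OF f, of u w v] by (elim exE conjE)
      let ?k = "vec2 0 a b"
      have k: "?k \<in> idx 2" "?k 0 = a" "?k 1 = b" by (auto simp: idx_def vec2_def)
      let ?T = "linform_mults (*) 2 (replicate (N u w) (xvar 0)) (\<lambda>k. f (YW (k 0) u (YW (k 1) v w)))"
      have T: "?T (antidiagonal 0 1 m ?k) = f (YW (a + int (N u w) - int m) u (YW (b + int m) v w))" for m
        using k by (simp add: c.linform_mults_replicate_xvar antidiagonal_def algebra_simps)
      have "translate (*) 0 1 ?T ?k = (\<Sum>m<B. translate_coef (?k 0) m * ?T (antidiagonal 0 1 m ?k))"
        by (rule c.translate_eq) (unfold T, use B f0 in simp)
      also have "\<dots> = (\<Sum>m<B. translate_coef a m * ?T (antidiagonal 0 1 m ?k))"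
        by (simp only: k(2))
      also have "\<dots> = f ?l" unfolding T hom ..
      finally have l: "f ?l = translate (*) 0 1 ?T ?k" ..
      have r: "f ?r = linform_mults (*) 2 (replicate (N u w) (\<lambda>m. xvar 0 m + xvar 1 m)) (\<lambda>k. f (YW (k 1) (YV (k 0) u v) w)) ?k"
        unfolding hom by (subst c.linform_mults_replicate_binary) (use k in auto)
      have "a' 0 \<le> N u w" using ab(1) by (simp add: N_def)
      then have e1: "f ?l = f ?r"
        unfolding l r by (rule weak_associativity_functional[OF f ab(2) _ k(1)])
      have e2: "f ?l = f (?l - ?r) + f ?r"
        using hom(1)[of "?l - ?r" ?r] unfolding diff_add_cancel .
      show "f (?l - ?r) = 0"
        by (rule add_cancel_left_left[THEN iffD1, OF trans[OF sym[OF e2] e1]])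
    qed
    then show "?l = ?r" by simp
  qed
  moreover have "YW k u w = 0" if "k \<ge> int (N u w)" for k u w
    using that by (intro K) (simp add: N_def)
  ultimately show ?thesis by (intro exI[of _ N] allI conjI impI)
qed

end

section \<open>Products of several vertex operators\<close>

lemma opprod_append: "opprod Y u k i (m + m') w = opprod Y u k i m (opprod Y u k (i + m) m' w)"
  by (induction m arbitrary: i) auto

lemma opprod_cong: "(\<And>j. i \<le> j \<Longrightarrow> j < i + m \<Longrightarrow> k j = k' j) \<Longrightarrow> opprod Y u k i m w = opprod Y u k' i m w"
  by (induction m arbitrary: i) auto

lemma linform_mults_compose:
  assumes "\<And>T l. l \<in> set ls \<Longrightarrow> linform_mult s n l (F T) = F (linform_mult s' n' l T)"
  shows "linform_mults s n ls (F T) = F (linform_mults s' n' ls T)"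
  using assms by (induction ls) auto

section \<open>Lists of factors and their behaviour under substitution\<close>

definition monomial_factors :: "nat \<Rightarrow> (nat \<Rightarrow> nat) \<Rightarrow> (nat \<Rightarrow> complex) list" where
  "monomial_factors n a = concat (map (\<lambda>i. replicate (a i) (xvar i)) [0..<n])"

text \<open>The recursion splits off the pairs containing the last variable, the only differences
  that the substitution changes.\<close>

fun difference_factors :: "nat \<Rightarrow> (nat \<Rightarrow> nat \<Rightarrow> nat) \<Rightarrow> (nat \<Rightarrow> complex) list" where
  "difference_factors 0 b = []"
| "difference_factors (Suc p) b = concat (map (\<lambda>i. replicate (b i p) (xdiff i p)) [0..<p]) @ difference_factors p b"

lemma monomial_factors_Suc: "monomial_factors (Suc p) a = monomial_factors p a @ replicate (a p) (xvar p)"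
  by (simp add: monomial_factors_def)

lemma set_monomial_factors: "l \<in> set (monomial_factors n a) \<Longrightarrow> \<exists>i<n. l = xvar i"
  by (auto simp: monomial_factors_def)

lemma set_difference_factors: "l \<in> set (difference_factors n b) \<Longrightarrow> \<exists>i j. i < j \<and> j < n \<and> l = xdiff i j"
proof (induction n)
  case (Suc n)
  then consider "l \<in> set (concat (map (\<lambda>i. replicate (b i n) (xdiff i n)) [0..<n]))" | "l \<in> set (difference_factors n b)"
    by auto
  then show ?case
  proof cases
    case 1
    then obtain i where "i < n" "l = xdiff i n" by auto
    then show ?thesis by blast
  next
    case 2 then show ?thesis using Suc.IH less_SucI by blast
  qed
qed simp

text \<open>The effect on a linear form of substituting x_i + x_p for x_i, for t \<le> i < p.\<close>

definition tailsub :: "nat \<Rightarrow> nat \<Rightarrow> (nat \<Rightarrow> complex) \<Rightarrow> nat \<Rightarrow> complex" where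
  "tailsub p t l = l(p := l p + (\<Sum>i\<in>{t..<p}. l i))"

lemma sum_xvar: "finite S \<Longrightarrow> (\<Sum>i\<in>S. xvar j i) = (if j \<in> S then 1 else 0)"
  by (simp add: xvar_def)

lemma tailsub_top: "tailsub p p l = l"
  by (simp add: tailsub_def)

lemma tailsub_Suc:
  "t < p \<Longrightarrow> (tailsub p (Suc t) l)(p := tailsub p (Suc t) l p + tailsub p (Suc t) l t) = tailsub p t l"
  by (auto simp: tailsub_def fun_eq_iff sum.atLeast_Suc_lessThan)

lemma tailsub_xvar: "t < p \<Longrightarrow> tailsub p (Suc t) (xvar t) = xvar t"
  "t < p \<Longrightarrow> tailsub p t (xvar t) = (\<lambda>m. xvar t m + xvar p m)"
  by (auto simp: tailsub_def sum_xvar fun_eq_iff xvar_def)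

lemma tailsub_xdiff: "i < p \<Longrightarrow> tailsub p 0 (xdiff i p) = xvar i"
  "i < j \<Longrightarrow> j < p \<Longrightarrow> tailsub p 0 (xdiff i j) = xdiff i j"
  by (auto simp: tailsub_def fun_eq_iff xdiff_def sum_subtractf sum_xvar) (auto simp: xvar_def)

text \<open>The result is exactly the list that clears a product of p operators on V acting on u_p:
  x_i - x_p has become the variable x_i, and the other differences persist.\<close>

lemma map_tailsub_difference_factors: "map (tailsub p 0) (difference_factors (Suc p) b) = monomial_factors p (\<lambda>i. b i p) @ difference_factors p b"
proof -
  have "map (tailsub p 0) (difference_factors p b) = difference_factors p b"
    by (rule map_idI) (use set_difference_factors tailsub_xdiff(2) in blast)
  moreover have "map (tailsub p 0) (concat (map (\<lambda>i. replicate (b i p) (xdiff i p)) [0..<p])) = monomial_factors p (\<lambda>i. b i p)"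
    unfolding monomial_factors_def map_concat map_map
    by (intro arg_cong[where f = concat] map_cong) (auto simp: tailsub_xdiff)
  ultimately show ?thesis by simp
qed

lemma monomial_factors_split:
  assumes "t < p"
  shows "\<exists>rest. mset (monomial_factors p a) = mset (rest @ replicate (a t) (xvar t))"
proof -
  have "[0..<p] = [0..<t] @ t # [Suc t..<p]"
    using assms upt_add_eq_append[of 0 t "p - t"] upt_conv_Cons[of t p] by simp
  then have "mset (monomial_factors p a) = mset ((concat (map (\<lambda>i. replicate (a i) (xvar i)) [0..<t]) @
     concat (map (\<lambda>i. replicate (a i) (xvar i)) [Suc t..<p])) @ replicate (a t) (xvar t))"
    unfolding monomial_factors_def by simp
  then show ?thesis by blast
qed

text \<open>The formal counterpart of the rationality claim. On V it is used with one function for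
  both \<open>N\<close> and \<open>M\<close>, because the vector acted on lies in V as well.\<close>

definition regular_products where
  "regular_products s Y N M n \<longleftrightarrow> (\<forall>u w. \<forall>i<n. regular i
     (linform_mults s n (monomial_factors n (\<lambda>i. N (u i) w) @ difference_factors n (\<lambda>i j. M (u i) (u j))) (\<lambda>k. opprod Y u k 0 n w)))"

context vertex_module
begin

lemma opprod_linear: "Vector_Spaces.linear sW sW (opprod YW u k i m)"
proof (induction m arbitrary: i)
  case 0
  show ?case by (simp add: fun_eq_iff[symmetric] W.W.linear_id[unfolded id_def])
next
  case (Suc m)
  have "opprod YW u k i (Suc m) = YW (k i) (u i) \<circ> opprod YW u k (Suc i) m" by (simp add: fun_eq_iff)
  then show ?case using Vector_Spaces.linear_compose[OF Suc W.lin_right] by metis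
qed

lemma opprod_zero [simp]: "opprod YW u k i m 0 = 0"
  by (induction m arbitrary: i) auto

text \<open>The hypothesis concerns V only, so W = V closes the induction. Regularity travels from
  \<open>mix 0\<close> back to the full product \<open>mix p\<close>, each substitution being undone
  by \<open>regular_of_translate\<close>. The powers of x_i, which turn into powers of x_i + x_p,
  pay for weak associativity on the way and do no harm at \<open>mix 0\<close>.\<close>

lemma regular_products_Suc:
  assumes truncated: "\<And>u w k. k \<ge> int (N u w) \<Longrightarrow> YW k u w = 0"
    and wa: "\<And>u v w. weakly_associative (N u w) u v w"
    and IH: "regular_products sV YV M M p"
  shows "regular_products sW YW N M (Suc p)"
  unfolding regular_products_def
proof (intro allI impI)
  fix u :: "nat \<Rightarrow> 'v" and w :: 'w and i :: nat
  assume i: "i < Suc p"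
  define n where "n = Suc p"
  define Nw where "Nw = (\<lambda>i. N (u i) w)"
  define Mw where "Mw = (\<lambda>i j. M (u i) (u j))"
  define F where "F = monomial_factors p Nw @ difference_factors (Suc p) Mw"
  \<comment> \<open>\<open>mix t\<close> multiplies the first \<open>t\<close> operators on W and the remaining ones, applied to \<open>u p\<close>, inside V.\<close>
  define mix where "mix = (\<lambda>t k. opprod YW u k 0 t (YW (k p) (opprod YV u k t (p - t) (u p)) w))"
  have mix_Suc: "mix (Suc t) k = opprod YW u k 0 t (YW (k t) (u t) (YW (k p) (opprod YV u k (Suc t) (p - Suc t) (u p)) w))" for t k
    unfolding mix_def using opprod_append[of YW u k 0 t 1] by simp
  have mix_t: "mix t k = opprod YW u k 0 t (YW (k p) (YV (k t) (u t) (opprod YV u k (Suc t) (p - Suc t) (u p))) w)"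
    if "t < p" for t k
  proof -
    have "p - t = Suc (p - Suc t)" using that by simp
    then show ?thesis unfolding mix_def by simp
  qed
  have trmix: "truncated t p (mix (Suc t))" if t: "t < p" for t
    unfolding truncated_def
  proof
    fix k
    let ?v = "opprod YV u k (Suc t) (p - Suc t) (u p)"
    obtain K where K: "\<And>k. k \<ge> K \<Longrightarrow> YW k ?v w = 0" using W.truncation by blast
    have "mix (Suc t) (antidiagonal t p m k) = 0" if m: "m \<ge> nat (K - k p)" for m
    proof -
      have "opprod YV u (antidiagonal t p m k) (Suc t) (p - Suc t) (u p) = ?v"
        by (rule opprod_cong) (auto simp: antidiagonal_def)
      then show ?thesis using K[of "k p + int m"] m t by (simp add: mix_Suc antidiagonal_def)
    qed
    then show "\<exists>B. \<forall>m\<ge>B. mix (Suc t) (antidiagonal t p m k) = 0" by blast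
  qed
  \<comment> \<open>Weak associativity underneath the first \<open>t\<close> operators, which are
    linear and do not involve the modes k t and k p. The vector \<open>?v\<close> varies with
    \<open>k\<close>, so the exponent must not depend on it.\<close>
  have phi_mix: "translate sW t p (linform_mults sW n (replicate (Nw t) (xvar t)) (mix (Suc t))) =
      linform_mults sW n (replicate (Nw t) (\<lambda>m. xvar t m + xvar p m)) (mix t)" if t: "t < p" for t
  proof
    fix k
    let ?v = "opprod YV u k (Suc t) (p - Suc t) (u p)"
    have tn: "t < n" "p < n" "t \<noteq> p" using t by (auto simp: n_def)
    obtain K where K: "\<And>k. k \<ge> K \<Longrightarrow> YW k ?v w = 0" using W.truncation by blast
    define B where "B = nat (K - k p)"
    interpret o: Vector_Spaces.linear sW sW "opprod YW u k 0 t" by (rule opprod_linear)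
    let ?k = "\<lambda>m. (antidiagonal t p m k)(t := antidiagonal t p m k t + int (Nw t))"
    have c: "opprod YV u (k(t := a, p := b)) (Suc t) (p - Suc t) (u p) = ?v"
      "opprod YW u (k(t := a, p := b)) 0 t x = opprod YW u k 0 t x" for a b x
      using t by (auto intro!: opprod_cong)
    have km: "?k m = k(t := k t + int (Nw t) - int m, p := k p + int m)" for m
      using t by (auto simp: antidiagonal_def fun_eq_iff)
    have l: "linform_mults sW n (replicate (Nw t) (xvar t)) (mix (Suc t)) (antidiagonal t p m k) =
        opprod YW u k 0 t (YW (k t + int (Nw t) - int m) (u t) (YW (k p + int m) ?v w))" for m
      unfolding W.W.linform_mults_replicate_xvar[OF tn(1)] km mix_Suc c using t by simp
    have K': "YW (k p + int m) ?v w = 0" if "m \<ge> B" for m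
      using that by (intro K) (simp add: B_def)
    have "translate sW t p (linform_mults sW n (replicate (Nw t) (xvar t)) (mix (Suc t))) k =
       (\<Sum>m<B. sW (translate_coef (k t) m) (opprod YW u k 0 t (YW (k t + int (Nw t) - int m) (u t) (YW (k p + int m) ?v w))))"
      by (subst W.W.translate_eq[of B]) (simp_all add: l K')
    also have "\<dots> = opprod YW u k 0 t (\<Sum>m<B. sW (translate_coef (k t) m) (YW (k t + int (Nw t) - int m) (u t) (YW (k p + int m) ?v w)))"
      by (simp only: o.sum o.scale)
    also have "(\<Sum>m<B. sW (translate_coef (k t) m) (YW (k t + int (Nw t) - int m) (u t) (YW (k p + int m) ?v w))) =
       (\<Sum>m\<le>Nw t. sW (of_nat (Nw t choose m)) (YW (k p + int m) (YV (k t + int (Nw t) - int m) (u t) ?v) w))"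
    proof -
      have "weakly_associative (Nw t) (u t) ?v w" unfolding Nw_def by (rule wa)
      note this[unfolded weakly_associative_def, THEN spec[of _ "k t"], THEN spec[of _ "k p"], THEN spec[of _ B]]
      then show ?thesis by (rule mp) (use K' in simp)
    qed
    also have "opprod YW u k 0 t \<dots> = (\<Sum>m\<le>Nw t. sW (of_nat (Nw t choose m))
        (opprod YW u k 0 t (YW (k p + int m) (YV (k t + int (Nw t) - int m) (u t) ?v) w)))"
      by (simp only: o.sum o.scale)
    also have "\<dots> = linform_mults sW n (replicate (Nw t) (\<lambda>m. xvar t m + xvar p m)) (mix t) k"
      unfolding W.W.linform_mults_replicate_binary[OF tn] mix_t[OF t] c using t by simp
    finally show "translate sW t p (linform_mults sW n (replicate (Nw t) (xvar t)) (mix (Suc t))) k =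
      linform_mults sW n (replicate (Nw t) (\<lambda>m. xvar t m + xvar p m)) (mix t) k" .
  qed
  have reg: "regular i (linform_mults sW n (map (tailsub p t) F) (mix t))" if "i < p" "t \<le> p" for i t
    using that(2)
  proof (induction t)
    case 0
    \<comment> \<open>None of these factors involves x_p, so they pass through the linear map
      sending v to Y(v, x_p) w, and the hypothesis on V applies.\<close>
    let ?F = "monomial_factors p (\<lambda>i. Mw i p) @ difference_factors p Mw"
    have "linform_mults sW n ?F (\<lambda>k. YW (k p) (opprod YV u k 0 p (u p)) w) =
        (\<lambda>k. YW (k p) (linform_mults sV p ?F (\<lambda>k. opprod YV u k 0 p (u p)) k) w)"
    proof (rule linform_mults_compose[where F = "\<lambda>T k. YW (k p) (T k) w"], rule ext)
      fix T and l :: "nat \<Rightarrow> complex" and k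
      interpret l: Vector_Spaces.linear sV sW "\<lambda>u. YW (k p) u w" by (rule W.lin_left)
      assume "l \<in> set ?F"
      then have "l p = 0"
        by (auto dest!: set_monomial_factors set_difference_factors simp: xvar_def xdiff_def)
      then show "linform_mult sW n l (\<lambda>k. YW (k p) (T k) w) k = YW (k p) (linform_mult sV p l T k) w"
        by (simp add: linform_mult_def n_def l.sum l.scale)
    qed
    then have "linform_mults sW n (map (tailsub p 0) (difference_factors (Suc p) Mw)) (mix 0) =
        (\<lambda>k. YW (k p) (linform_mults sV p ?F (\<lambda>k. opprod YV u k 0 p (u p)) k) w)"
      unfolding map_tailsub_difference_factors mix_def by simp
    moreover have "regular i (linform_mults sV p ?F (\<lambda>k. opprod YV u k 0 p (u p)))"
      using IH that(1) unfolding regular_products_def Mw_def by blast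
    ultimately have "regular i (linform_mults sW n (map (tailsub p 0) (difference_factors (Suc p) Mw)) (mix 0))"
      by (simp add: regular_def)
    then show ?case
      unfolding F_def map_append linform_mults_append by (rule W.W.linform_mults_regular)
  next
    case (Suc t)
    then have t: "t < p" "t \<noteq> p" "t < n" "p < n" by (auto simp: n_def)
    \<comment> \<open>The powers of x_t are moved next to \<open>mix (Suc t)\<close>, where
      \<open>phi_mix\<close> consumes them.\<close>
    obtain rest0 where rest0: "mset (monomial_factors p Nw) = mset (rest0 @ replicate (Nw t) (xvar t))"
      using monomial_factors_split[OF t(1)] by blast
    define rest where "rest = rest0 @ difference_factors (Suc p) Mw"
    have "mset F = mset (rest @ replicate (Nw t) (xvar t))"
      unfolding F_def rest_def using rest0 by simp
    then have perm: "linform_mults sW n (map (tailsub p t') F) = linform_mults sW n (map (tailsub p t') (rest @ replicate (Nw t) (xvar t)))" for t'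
      by (intro W.W.linform_mults_mset) (simp only: mset_map)
    have mx: "map (tailsub p (Suc t)) (replicate (Nw t) (xvar t)) = replicate (Nw t) (xvar t)"
      "map (tailsub p t) (replicate (Nw t) (xvar t)) = replicate (Nw t) (\<lambda>m. xvar t m + xvar p m)"
      using tailsub_xvar[OF t(1)] by simp_all
    have tr: "truncated t p (linform_mults sW n ls (mix (Suc t)))" for ls
      using t trmix by (intro W.W.truncated_linform_mults) auto
    have "translate sW t p (linform_mults sW n (map (tailsub p (Suc t)) F) (mix (Suc t))) =
      linform_mults sW n (map (tailsub p t) rest) (translate sW t p (linform_mults sW n (replicate (Nw t) (xvar t)) (mix (Suc t))))"
      unfolding perm map_append linform_mults_append mx W.W.translate_linform_mults[OF t(2,3,4) tr] map_map o_def tailsub_Suc[OF t(1)] ..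
    also have "\<dots> = linform_mults sW n (map (tailsub p t) F) (mix t)"
      unfolding phi_mix[OF t(1)] perm map_append linform_mults_append mx ..
    finally have e: "translate sW t p (linform_mults sW n (map (tailsub p (Suc t)) F) (mix (Suc t))) =
      linform_mults sW n (map (tailsub p t) F) (mix t)" .
    show ?case
    proof (rule W.W.regular_of_translate[OF t(2) tr])
      show "i \<noteq> p" using that(1) by simp
      show "regular i (translate sW t p (linform_mults sW n (map (tailsub p (Suc t)) F) (mix (Suc t))))"
        unfolding e by (rule Suc.IH) (use t in simp)
    qed
  qed
  have mixp: "mix p = (\<lambda>k. opprod YW u k 0 (Suc p) w)"
    unfolding mix_def using opprod_append[of YW u _ 0 p 1] by (simp add: fun_eq_iff)
  have m: "mset (monomial_factors (Suc p) Nw @ difference_factors (Suc p) Mw) = mset (replicate (Nw p) (xvar p) @ F)"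
    "mset (monomial_factors (Suc p) Nw @ difference_factors (Suc p) Mw) = mset (F @ replicate (Nw p) (xvar p))"
    unfolding F_def monomial_factors_Suc by simp_all
  have "regular i (linform_mults sW n (monomial_factors (Suc p) Nw @ difference_factors (Suc p) Mw) (\<lambda>k. opprod YW u k 0 (Suc p) w))"
  proof (cases "i = p")
    case True
    \<comment> \<open>The variable x_p belongs to the innermost operator, which annihilates w from
      mode \<open>Nw p\<close> on.\<close>
    have "regular i (linform_mults sW n (replicate (Nw p) (xvar p)) (\<lambda>k. opprod YW u k 0 (Suc p) w))"
      unfolding regular_def
    proof (intro allI impI)
      fix k :: "nat \<Rightarrow> int" assume k: "0 \<le> k i"
      let ?k = "k(p := k p + int (Nw p))"
      have "YW (?k p) (u p) w = 0" using k True by (intro truncated) (simp add: Nw_def)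
      then have "mix p ?k = 0" by (simp add: mix_def)
      then show "linform_mults sW n (replicate (Nw p) (xvar p)) (\<lambda>k. opprod YW u k 0 (Suc p) w) k = 0"
        unfolding mixp by (subst W.W.linform_mults_replicate_xvar) (auto simp: n_def)
    qed
    then show ?thesis
      unfolding W.W.linform_mults_mset[OF m(2)] linform_mults_append by (rule W.W.linform_mults_regular)
  next
    case False
    have "map (tailsub p p) F = F" by (simp add: tailsub_top map_idI)
    then have "regular i (linform_mults sW n F (mix p))"
      using reg[of i p] i False by simp
    then show ?thesis
      unfolding W.W.linform_mults_mset[OF m(1)] linform_mults_append mixp by (rule W.W.linform_mults_regular)
  qed
  then show "regular i (linform_mults sW (Suc p) (monomial_factors (Suc p) (\<lambda>i. N (u i) w) @ difference_factors (Suc p) (\<lambda>i j. M (u i) (u j)))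
      (\<lambda>k. opprod YW u k 0 (Suc p) w))"
    unfolding n_def Nw_def Mw_def .
qed

end

section \<open>From regular series to rational functions\<close>

lemma eval_xvar: "i < n \<Longrightarrow> (\<Sum>j<n. xvar i j * z j) = z i"
  by (simp add: xvar_def if_distrib[of "\<lambda>c. c * _"] cong: if_cong)

lemma eval_xdiff: "i < n \<Longrightarrow> j < n \<Longrightarrow> (\<Sum>m<n. xdiff i j m * z m) = z i - z j"
  by (simp add: xdiff_def left_diff_distrib sum_subtractf eval_xvar)

lemma prod_replicates:
  "(\<Prod>l\<leftarrow>concat (map (\<lambda>i. replicate (c i) (g i)) [0..<m]). h l) = (\<Prod>i<m. (h (g i) :: complex) ^ c i)"
proof (induction m)
  case (Suc m)
  have "(\<Prod>l\<leftarrow>replicate r x. h l) = h x ^ r" for r x by (induction r) auto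
  then show ?case using Suc by simp
qed simp

lemma prod_monomial_factors: "m \<le> n \<Longrightarrow> (\<Prod>l\<leftarrow>monomial_factors m a. \<Sum>j<n. l j * z j) = (\<Prod>i<m. z i ^ a i)"
  unfolding monomial_factors_def prod_replicates by (intro prod.cong) (auto simp: eval_xvar)

lemma prod_difference_factors:
  "m \<le> n \<Longrightarrow> (\<Prod>l\<leftarrow>difference_factors m b. \<Sum>j<n. l j * z j) = (\<Prod>i<m. \<Prod>j\<in>{i<..<m}. (z i - z j) ^ b i j)"
proof (induction m)
  case (Suc m)
  have "(\<Prod>i<Suc m. \<Prod>j\<in>{i<..<Suc m}. (z i - z j) ^ b i j) = (\<Prod>i<m. \<Prod>j\<in>{i<..<Suc m}. (z i - z j) ^ b i j)"
  proof -
    have "{m<..<Suc m} = {}" by auto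
    then show ?thesis by simp
  qed
  also have "\<dots> = (\<Prod>i<m. (z i - z m) ^ b i m * (\<Prod>j\<in>{i<..<m}. (z i - z j) ^ b i j))"
  proof (intro prod.cong refl)
    fix i assume "i \<in> {..<m}"
    then have "{i<..<Suc m} = insert m {i<..<m}" by auto
    then show "(\<Prod>j\<in>{i<..<Suc m}. (z i - z j) ^ b i j) = (z i - z m) ^ b i m * (\<Prod>j\<in>{i<..<m}. (z i - z j) ^ b i j)"
      by simp
  qed
  also have "\<dots> = (\<Prod>i<m. (z i - z m) ^ b i m) * (\<Prod>l\<leftarrow>difference_factors m b. \<Sum>j<n. l j * z j)"
    using Suc by (simp add: prod.distrib)
  also have "(\<Prod>i<m. (z i - z m) ^ b i m) =
      (\<Prod>l\<leftarrow>concat (map (\<lambda>i. replicate (b i m) (xdiff i m)) [0..<m]). \<Sum>j<n. l j * z j)"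
    unfolding prod_replicates using Suc.prems by (intro prod.cong) (auto simp: eval_xdiff)
  finally show ?case by simp
qed simp

lemma Dprod_less: "z \<in> Dprod n \<Longrightarrow> i < j \<Longrightarrow> j < n \<Longrightarrow> norm (z j) < norm (z i)"
proof (induction j)
  case (Suc j)
  then have "norm (z (Suc j)) < norm (z j)" by (auto simp: Dprod_def)
  then show ?case using Suc by (cases "i = j") auto
qed simp

text \<open>Factors are removed one at a time from the outside: x_i by an index shift, x_i - x_j by
  the geometric series, since earlier variables dominate later ones on \<open>Dprod n\<close>.
  Truncation survives the factors that remain.\<close>

lemma has_sum_factors_cancel:
  assumes z: "z \<in> Dprod n"
    and ls: "\<And>l. l \<in> set ls \<Longrightarrow> (\<exists>i<n. l = xvar i) \<or> (\<exists>i j. i < j \<and> j < n \<and> l = xdiff i j)"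
    and tr: "\<And>i j. i < j \<Longrightarrow> j < n \<Longrightarrow> truncated i j A"
    and S: "((\<lambda>k. linform_mults (*) n ls A k * mode_monomial n z k) has_sum R) (idx n)"
  shows "((\<lambda>k. A k * mode_monomial n z k) has_sum R / (\<Prod>l\<leftarrow>ls. \<Sum>j<n. l j * z j)) (idx n)"
  using ls S
proof (induction ls arbitrary: R)
  case (Cons l ls)
  interpret c: complex_vector_space "(*) :: complex \<Rightarrow> complex \<Rightarrow> complex" by (rule complex_vector_space_complex)
  have z0: "z i \<noteq> 0" if "i < n" for i using z that by (auto simp: Dprod_def)
  let ?T = "linform_mults (*) n ls A"
  have S: "((\<lambda>k. linform_mult (*) n l ?T k * mode_monomial n z k) has_sum R) (idx n)"
    using Cons.prems(2) by simp
  have "((\<lambda>k. ?T k * mode_monomial n z k) has_sum R / (\<Sum>j<n. l j * z j)) (idx n)"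
    using Cons.prems(1)[of l, simplified]
  proof
    assume "\<exists>i<n. l = xvar i"
    then obtain i where i: "i < n" "l = xvar i" by blast
    have "((\<lambda>k. ?T (k(i := k i + 1)) * mode_monomial n z k) has_sum R / z i * z i) (idx n)"
      using S z0[OF i(1)] unfolding i(2) c.linform_mult_xvar[OF i(1)] by simp
    then show ?thesis
      using has_sum_bump_iff[of i n z ?T "R / z i"] i z0 by (simp add: eval_xvar)
  next
    assume "\<exists>i j. i < j \<and> j < n \<and> l = xdiff i j"
    then obtain i j where ij: "i < j" "j < n" "l = xdiff i j" by blast
    have "((\<lambda>k. ?T k * mode_monomial n z k) has_sum R / (z i - z j)) (idx n)"
      using ij z0 Dprod_less[OF z ij(1,2)] S
      by (intro has_sum_xdiff_cancel c.truncated_linform_mults tr) auto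
    then show ?thesis using ij by (simp add: eval_xdiff)
  qed
  from Cons.IH[OF _ this] Cons.prems(1) show ?case by simp
qed simp

text \<open>Each linear factor lowers the sum of the modes by 1.\<close>

lemma linform_mult_degree:
  assumes "finite D" "\<And>k. T k \<noteq> 0 \<Longrightarrow> (\<Sum>j<n. k j) \<in> D"
  shows "\<exists>D::int set. finite D \<and> (\<forall>k. linform_mults (*) n ls (T :: _ \<Rightarrow> complex) k \<noteq> 0 \<longrightarrow> (\<Sum>j<n. k j) \<in> D)"
proof (induction ls)
  case (Cons l ls)
  then obtain D where D: "finite D" "\<And>k. linform_mults (*) n ls T k \<noteq> 0 \<Longrightarrow> (\<Sum>j<n. k j) \<in> D" by blast
  show ?case
  proof (intro exI[of _ "(\<lambda>d. d - 1) ` D"] conjI allI impI)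
    fix k assume "linform_mults (*) n (l # ls) T k \<noteq> 0"
    then have "\<exists>i<n. linform_mults (*) n ls T (k(i := k i + 1)) \<noteq> 0"
      by (rule contrapos_np) (auto simp: linform_mult_def intro!: sum.neutral)
    then obtain i where i: "i < n" "linform_mults (*) n ls T (k(i := k i + 1)) \<noteq> 0" by blast
    have "(\<Sum>j<n. (k(i := k i + 1)) j) = (\<Sum>j<n. k j + (if j = i then 1 else 0))"
      by (intro sum.cong) auto
    also have "\<dots> = (\<Sum>j<n. k j) + 1" using i by (simp add: sum.distrib)
    finally have "(\<Sum>j<n. k j) + 1 \<in> D" using D(2)[OF i(2)] by simp
    then show "(\<Sum>j<n. k j) \<in> (\<lambda>d. d - 1) ` D" by (intro image_eqI[of _ _ "(\<Sum>j<n. k j) + 1"]) auto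
  qed (use D in simp)
qed (use assms in auto)

text \<open>When all modes are negative, each of them is at least their sum.\<close>

lemma finite_idx_degree:
  assumes "finite (D :: int set)"
  shows "finite {k \<in> idx n. (\<forall>i<n. k i < 0) \<and> (\<Sum>j<n. k j) \<in> D}"
proof (cases "D = {}")
  case False
  have "{k \<in> idx n. (\<forall>i<n. k i < 0) \<and> (\<Sum>j<n. k j) \<in> D} \<subseteq>
      {k. \<forall>i. (i \<in> {..<n} \<longrightarrow> k i \<in> {Min D..0}) \<and> (i \<notin> {..<n} \<longrightarrow> k i = 0)}"
  proof (intro subsetI CollectI allI conjI impI)
    fix k i assume "k \<in> {k \<in> idx n. (\<forall>i<n. k i < 0) \<and> (\<Sum>j<n. k j) \<in> D}"
    then have k: "k \<in> idx n" "\<forall>i<n. k i < 0" "(\<Sum>j<n. k j) \<in> D" by auto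
    show "k i = 0" if "i \<notin> {..<n}" using k that by (auto simp: idx_def)
    assume "i \<in> {..<n}"
    then have i: "i < n" by simp
    have "(\<Sum>j<n. k j) = k i + (\<Sum>j\<in>{..<n}-{i}. k j)" using i by (subst sum.remove[of _ i]) auto
    also have "(\<Sum>j\<in>{..<n}-{i}. k j) \<le> 0" using k by (intro sum_nonpos) (auto intro: less_imp_le)
    finally have "(\<Sum>j<n. k j) \<le> k i" by simp
    moreover have "Min D \<le> (\<Sum>j<n. k j)" by (rule Min_le[OF assms k(3)])
    moreover have "k i < 0" using k i by blast
    ultimately show "k i \<in> {Min D..0}" by simp
  qed
  then show ?thesis
    using finite_set_of_finite_funs[of "{..<n}" "{Min D..0}" 0] finite_subset by blast
qed simp

lemma (in vertex_module) conv_rat_of_regular: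
  assumes R: "regular_products sW YW N M n" and f: "f \<in> gdual sW GW"
  shows "conv_rat n (prod_term YW f u n w) (Dprod n) (\<lambda>i. N (u i) w) (\<lambda>i j. M (u i) (u j))"
proof -
  define a where "a = (\<lambda>i. N (u i) w)"
  define b where "b = (\<lambda>i j. M (u i) (u j))"
  define A where "A = (\<lambda>k. f (opprod YW u k 0 n w))"
  let ?ls = "monomial_factors n a @ difference_factors n b"
  have lin: "Vector_Spaces.linear sW (*) f" using f by (simp add: gdual_def)
  have f0: "f 0 = 0" using functional_hom(2)[OF lin, of 0 0] by simp
  have reg: "regular i (linform_mults (*) n ?ls A)" if "i < n" for i
    using R that linear_linform_mults[OF lin, of n ?ls "\<lambda>k. opprod YW u k 0 n w"]
    unfolding regular_products_def regular_def a_def b_def A_def by (metis f0)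
  obtain D where D: "finite D" "\<And>k. A k \<noteq> 0 \<Longrightarrow> (\<Sum>j<n. k j) \<in> D"
    unfolding A_def by (rule W.opprod_degree[OF f]) blast
  obtain D' where D': "finite D'" "\<And>k. linform_mults (*) n ?ls A k \<noteq> 0 \<Longrightarrow> (\<Sum>j<n. k j) \<in> D'"
    using linform_mult_degree[OF D] by blast
  have "finite {k \<in> idx n. linform_mults (*) n ?ls A k \<noteq> 0}"
  proof (rule finite_subset[OF _ finite_idx_degree[OF D'(1)]], safe)
    fix k i assume "linform_mults (*) n ?ls A k \<noteq> 0" "i < n"
    then show "k i < 0" using regularD[OF reg] by (meson not_less)
  qed (use D'(2) in auto)
  then obtain P where P: "mpoly n P"
    "\<And>z. ((\<lambda>k. linform_mults (*) n ?ls A k * mode_monomial n z k) has_sum mpoly_eval n P z) (idx n)"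
    using has_sum_mpoly reg by blast
  \<comment> \<open>The operators to the right of position j do not change along this antidiagonal,
    while the mode of u_j grows against the fixed vector \<open>?w\<close>. The order i < j is what
    matches the expansion in x_j / x_i.\<close>
  have tr: "truncated i j A" if ij: "i < j" "j < n" for i j
    unfolding truncated_def
  proof
    fix k
    let ?w = "opprod YW u k (Suc j) (n - Suc j) w"
    obtain K where K: "\<And>k. k \<ge> K \<Longrightarrow> YW k (u j) ?w = 0" using W.truncation by blast
    have "A (antidiagonal i j m k) = 0" if m: "m \<ge> nat (K - k j)" for m
    proof -
      let ?k = "antidiagonal i j m k"
      have "opprod YW u ?k 0 n w = opprod YW u ?k 0 j (opprod YW u ?k j (Suc (n - Suc j)) w)"
        using opprod_append[of YW u ?k 0 j "Suc (n - Suc j)" w] ij by simp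
      also have "opprod YW u ?k (Suc j) (n - Suc j) w = ?w"
        using ij by (intro opprod_cong) (auto simp: antidiagonal_def)
      then have "opprod YW u ?k j (Suc (n - Suc j)) w = 0"
        using K[of "k j + int m"] m ij by (simp add: antidiagonal_def)
      finally show ?thesis by (simp add: A_def f0)
    qed
    then show "\<exists>B. \<forall>m\<ge>B. A (antidiagonal i j m k) = 0" by blast
  qed
  have "((\<lambda>k. prod_term YW f u n w k z) has_sum rat_fun n P a b z) (idx n)" if z: "z \<in> Dprod n" for z
  proof -
    have "((\<lambda>k. A k * mode_monomial n z k) has_sum mpoly_eval n P z / (\<Prod>l\<leftarrow>?ls. \<Sum>j<n. l j * z j)) (idx n)"
      by (rule has_sum_factors_cancel[OF z _ tr P(2)]) (auto dest!: set_monomial_factors set_difference_factors)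
    then show ?thesis
      by (simp add: rat_fun_def prod_term_def A_def mode_monomial_def prod_monomial_factors prod_difference_factors)
  qed
  then have "conv_rat n (prod_term YW f u n w) (Dprod n) a b"
    unfolding conv_rat_def summable_on_iff_abs_summable_on_complex[symmetric]
    by (intro exI[of _ P] conjI ballI P(1)) (auto dest: has_sum_imp_summable)
  then show ?thesis unfolding a_def b_def .
qed

theorem mainTheorem1:
  fixes sV :: "complex \<Rightarrow> 'v::ab_group_add \<Rightarrow> 'v"
    and GV :: "int \<Rightarrow> 'v set"
    and YV :: "int \<Rightarrow> 'v \<Rightarrow> 'v \<Rightarrow> 'v"
    and vac :: 'v
    and dV :: "'v \<Rightarrow> 'v"
    and sW :: "complex \<Rightarrow> 'w::ab_group_add \<Rightarrow> 'w"
    and GW :: "complex \<Rightarrow> 'w set"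
    and YW :: "int \<Rightarrow> 'v \<Rightarrow> 'w \<Rightarrow> 'w"
    and dW :: "'w \<Rightarrow> 'w"
    and DW :: "'w \<Rightarrow> 'w"
  assumes V: "mosva sV GV YV vac dV"
    and V_pole: "pole_order sV GV YV"
    and W_graded: "graded sW GW"
    and YW_lin: "bilinear_Y sV sW YW"
    and W_lower: "\<exists>M. \<forall>m. Re m < M \<longrightarrow> GW m = {0}"
    and dW_lin: "Vector_Spaces.linear sW sW dW"
    and dW_wt: "\<forall>m. \<forall>w\<in>GW m. dW w = sW m w"
    and dW_comm: "\<forall>k u w. dW (YW k u w) - YW k u (dW w) = YW k (dV u) w + sW (of_int (- k - 1)) (YW k u w)"
    and DW_lin: "Vector_Spaces.linear sW sW DW"
    and DW_wt: "\<forall>m. \<forall>w\<in>GW m. DW w \<in> GW (m + 1)"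
    and D_deriv: "\<forall>k u w. YW k (YV (-2) u vac) w = sW (of_int (- k)) (YW (k - 1) u w)"
    and D_comm: "\<forall>k u w. DW (YW k u w) - YW k u (DW w) = sW (of_int (- k)) (YW (k - 1) u w)"
    and W_rat_prod: "\<forall>n\<le>2. rational_prod sW GW YW n"
    and W_rat_iter: "rational_iter sW GW YW YV"
    and W_assoc: "assoc_ax sW GW YW YV"
    and W_pole: "pole_order sW GW YW"
  shows "\<exists>(N :: 'v \<Rightarrow> 'w \<Rightarrow> nat) (M :: 'v \<Rightarrow> 'v \<Rightarrow> nat).
           \<forall>n\<ge>1. \<forall>u w. \<forall>f\<in>gdual sW GW. \<exists>a b.
             (\<forall>i<n. a i \<le> N (u i) w) \<and> (\<forall>i j. i < j \<and> j < n \<longrightarrow> b i j \<le> M (u i) (u j)) \<and>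
             conv_rat n (prod_term YW f u n w) (Dprod n) a b"
proof -
  have Vg: "graded sV GV" "\<exists>M. \<forall>n<M. GV n = {0}" "Vector_Spaces.linear sV sV dV"
      "\<And>n v. v \<in> GV n \<Longrightarrow> dV v = sV (of_int n) v"
    and Vb: "bilinear_Y sV sV YV"
      "\<And>k u v. dV (YV k u v) - YV k u (dV v) = sV (of_int (- k - 1)) (YV k u v) + YV k (dV u) v"
    and Va: "rational_iter sV GV YV YV" "assoc_ax sV GV YV YV"
    using V unfolding mosva_def by auto
  obtain M0 :: int where M0: "\<And>n. n < M0 \<Longrightarrow> GV n = {0}" using Vg(2) by blast
  interpret V: graded_space sV GV of_int dV
  proof (intro graded_space.intro graded_space_axioms.intro)
    show "complex_vector_space sV" using Vg(1) unfolding complex_vector_space_def graded_def by (elim conjE)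
    show "\<exists>M. \<forall>m. Re (of_int m) < M \<longrightarrow> GV m = {0}"
      by (intro exI[of _ "of_int M0"] allI impI M0) simp
  qed (use Vg in auto)
  interpret W: graded_space sW GW "\<lambda>m. m" dW
  proof (intro graded_space.intro graded_space_axioms.intro)
    show "complex_vector_space sW" using W_graded unfolding complex_vector_space_def graded_def by (elim conjE)
  qed (use W_graded dW_lin dW_wt W_lower in auto)
  interpret VV: graded_action sV GV of_int dV sV GV of_int dV YV
    by unfold_locales (use Vb in \<open>auto simp: add.commute\<close>)
  interpret VW: graded_action sV GV of_int dV sW GW "\<lambda>m. m" dW YW
    by unfold_locales (use YW_lin dW_comm in auto)
  interpret VM: vertex_module sV GV of_int dV YV sV GV of_int dV YV
    by unfold_locales (use Va V_pole in auto)
  interpret WM: vertex_module sV GV of_int dV YV sW GW "\<lambda>m. m" dW YW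
    by unfold_locales (use W_rat_iter W_assoc W_pole in auto)
  \<comment> \<open>The exponent on V, with its second argument read as u_j, is the bound for the
    pole z_i = z_j.\<close>
  obtain M where M: "\<And>u w k. k \<ge> int (M u w) \<Longrightarrow> YV k u w = 0" "\<And>u v w. VM.weakly_associative (M u w) u v w"
    using VM.weak_associativity by blast
  obtain N where N: "\<And>u w k. k \<ge> int (N u w) \<Longrightarrow> YW k u w = 0" "\<And>u v w. WM.weakly_associative (N u w) u v w"
    using WM.weak_associativity by blast
  have RV: "regular_products sV YV M M n" for n
  proof (induction n)
    case 0
    show ?case by (simp add: regular_products_def)
  next
    case (Suc n)
    show ?case by (rule VM.regular_products_Suc[OF M Suc])
  qed
  \<comment> \<open>One passage from products of n - 1 operators on V; this is where n >= 1
    enters.\<close>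
  have "regular_products sW YW N M n" if "n \<ge> 1" for n
    using WM.regular_products_Suc[OF N RV, of "n - 1"] that by simp
  then have c: "conv_rat n (prod_term YW f u n w) (Dprod n) (\<lambda>i. N (u i) w) (\<lambda>i j. M (u i) (u j))"
    if "n \<ge> 1" "f \<in> gdual sW GW" for n f u w
    using that by (intro WM.conv_rat_of_regular)
  show ?thesis
  proof (intro exI[of _ N] exI[of _ M] allI impI ballI)
    fix n :: nat and u w f assume "1 \<le> n" "f \<in> gdual sW GW"
    then show "\<exists>a b. (\<forall>i<n. a i \<le> N (u i) w) \<and> (\<forall>i j. i < j \<and> j < n \<longrightarrow> b i j \<le> M (u i) (u j)) \<and>
        conv_rat n (prod_term YW f u n w) (Dprod n) a b"
      by (intro exI[of _ "\<lambda>i. N (u i) w"] exI[of _ "\<lambda>i j. M (u i) (u j)"] conjI c) auto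
  qed
qed

end
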